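(* For every integer $N\geq 3$, $$\varepsilon_1(N,2)=2\sum_{i=0}^{N-3}\Bigl(\varepsilon_0(i)\,\varepsilon_1(N-i-1,2)+\varepsilon_0(i,2)\,\varepsilon_1(N-i-1)\Bigr)+N(2N-1)\,\varepsilon_1(N-1)+\varepsilon_0(N-1,3).$$
   Context: Let $N\ge 1$, $K\ge 1$. A gluing datum with $N$ edges and $K$ faces consists of a composition $(m_1,\dots,m_K)$ of $2N$ into positive integers and a fixed-point-free involution $\iota$ of $\{1,\dots,2N\}$. With $s_0=0$, $s_i=m_1+\dots+m_i$, let $\tau$ have cycles $(s_{i-1}+1,\dots,s_i)$, $i=1,\dots,K$. The datum is connected if $\langle\iota,\tau\rangle$ acts transitively, and has genus $g$ if $\tau\iota$ has exactly $N-K+2-2g$ cycles. (Geometrically: gluing $K$ numbered polygons with distinguished edges into a connected closed orientable surface of genus $g$.) $\varepsilon_g(N,K)$ is the number of connected genus-$g$ data; $\varepsilon_0(0,1)=1$, $\varepsilon_g(0,K)=0$ if $g+K>1$; $\varepsilon_g(N):=\varepsilon_g(N,1)$. *)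

theory Defs
  imports "HOL-Algebra.Sym_Groups" "HOL-Combinatorics.Orbits"
begin

definition partial_sum :: "nat list \<Rightarrow> nat \<Rightarrow> nat" where
  "partial_sum ms i = sum_list (take i ms)"

definition face_perm :: "nat list \<Rightarrow> nat \<Rightarrow> nat" where
  "face_perm ms =
     foldr (\<lambda>i p. cycle_of_list [partial_sum ms i + 1 ..< partial_sum ms (i + 1) + 1] \<circ> p)
       [0..<length ms] id"

text \<open>Involutions are functions on all of \<^typ>\<open>nat\<close>; \<^const>\<open>permutes\<close> makes them the
  identity outside \<^term>\<open>{1..2 * N}\<close>, so every involution of that set is represented
  exactly once.\<close>

definition gluing_data :: "nat \<Rightarrow> nat \<Rightarrow> (nat list \<times> (nat \<Rightarrow> nat)) set" where
  "gluing_data N K = {(ms, \<iota>).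
     length ms = K \<and> (\<forall>m \<in> set ms. 0 < m) \<and> sum_list ms = 2 * N \<and>
     \<iota> permutes {1..2 * N} \<and> \<iota> \<circ> \<iota> = id \<and> (\<forall>x \<in> {1..2 * N}. \<iota> x \<noteq> x)}"

definition connected_datum :: "nat \<Rightarrow> nat list \<times> (nat \<Rightarrow> nat) \<Rightarrow> bool" where
  "connected_datum N = (\<lambda>(ms, \<iota>).
     \<forall>x \<in> {1..2 * N}. \<forall>y \<in> {1..2 * N}.
       \<exists>\<sigma> \<in> generate (sym_group (2 * N)) {\<iota>, face_perm ms}. \<sigma> x = y)"

text \<open>Fixed points count as cycles.\<close>

definition num_cycles :: "nat \<Rightarrow> (nat \<Rightarrow> nat) \<Rightarrow> nat" where
  "num_cycles n p = card (orbit p ` {1..n})"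

definition genus_datum :: "nat \<Rightarrow> nat \<Rightarrow> nat \<Rightarrow> nat list \<times> (nat \<Rightarrow> nat) \<Rightarrow> bool" where
  "genus_datum g N K = (\<lambda>(ms, \<iota>).
     int (num_cycles (2 * N) (face_perm ms \<circ> \<iota>)) = int N - int K + 2 - 2 * int g)"

definition eps :: "nat \<Rightarrow> nat \<Rightarrow> nat \<Rightarrow> nat" where
  "eps g N K =
     (if N = 0 then (if g = 0 \<and> K = 1 then 1 else 0)
      else card {d \<in> gluing_data N K. connected_datum N d \<and> genus_datum g N K d})"

abbreviation eps_one :: "nat \<Rightarrow> nat \<Rightarrow> nat" where
  "eps_one g N \<equiv> eps g N 1"


lemma cycle_of_list_upt:
  assumes "a \<le> x" "x < b"
  shows "cycle_of_list [a..<b] x = (if Suc x = b then a else Suc x)"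
  using assms
proof (induction "b - a" arbitrary: a x)
  case 0
  then show ?case by simp
next
  case (Suc n)
  show ?case
  proof (cases "Suc a = b")
    case True
    then show ?thesis using Suc.prems by (simp add: upt_rec)
  next
    case False
    then have ab: "Suc a < b" using Suc.prems by simp
    then have l: "[a..<b] = a # Suc a # [Suc (Suc a)..<b]"
      by (simp add: upt_rec)
    have l2: "Suc a # [Suc (Suc a)..<b] = [Suc a..<b]"
      using ab by (simp add: upt_rec)
    have e: "cycle_of_list [a..<b] x = transpose a (Suc a) (cycle_of_list [Suc a..<b] x)"
      using cycle_of_list.simps(1)[of a "Suc a" "[Suc (Suc a)..<b]"] l l2
      by (metis comp_apply)
    show ?thesis
    proof (cases "x = a")
      case True
      then have "cycle_of_list [Suc a..<b] x = a" by (simp add: id_outside_supp)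
      then show ?thesis using e True ab by simp
    next
      case False
      then have "cycle_of_list [Suc a..<b] x = (if Suc x = b then Suc a else Suc x)"
        using Suc.hyps(1)[of "Suc a" x] Suc.hyps(2) Suc.prems by simp
      then show ?thesis using e False Suc.prems by (auto simp: transpose_def)
    qed
  qed
qed

lemma partial_sum_mono: "i \<le> j \<Longrightarrow> partial_sum ms i \<le> partial_sum ms j"
  unfolding partial_sum_def by (metis le_add1 le_add_diff_inverse sum_list_append take_add)

lemma foldr_cycles_other:
  assumes "\<And>i. i \<in> set is \<Longrightarrow> x \<notin> set (c i)"
  shows "foldr (\<lambda>i p. cycle_of_list (c i) \<circ> p) is id x = x"
  using assms by (induction "is") (auto simp: id_outside_supp)

lemma foldr_cycles_in:
  assumes "distinct is" "j \<in> set is" "x \<in> set (c j)"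
    and "\<And>i. i \<in> set is \<Longrightarrow> i \<noteq> j \<Longrightarrow> set (c i) \<inter> set (c j) = {}"
  shows "foldr (\<lambda>i p. cycle_of_list (c i) \<circ> p) is id x = cycle_of_list (c j) x"
  using assms
proof (induction "is")
  case Nil
  then show ?case by simp
next
  case (Cons i "is")
  have step: "foldr (\<lambda>i p. cycle_of_list (c i) \<circ> p) (i # is) id x =
      cycle_of_list (c i) (foldr (\<lambda>i p. cycle_of_list (c i) \<circ> p) is id x)"
    by simp
  show ?case
  proof (cases "i = j")
    case True
    have "foldr (\<lambda>i p. cycle_of_list (c i) \<circ> p) is id x = x"
      by (rule foldr_cycles_other) (use Cons.prems True in fastforce)
    then show ?thesis using True step by metis
  next
    case False
    have IH: "foldr (\<lambda>i p. cycle_of_list (c i) \<circ> p) is id x = cycle_of_list (c j) x"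
      by (rule Cons.IH) (use Cons.prems False in auto)
    have "cycle_of_list (c j) x \<in> set (c j)"
      using permutes_in_image[OF cycle_permutes] Cons.prems(3) by fast
    then have "cycle_of_list (c j) x \<notin> set (c i)"
      using Cons.prems(4)[of i] False by auto
    then show ?thesis using IH step by (metis id_outside_supp)
  qed
qed

lemma face_perm_apply:
  assumes "i < length ms" "partial_sum ms i < x" "x \<le> partial_sum ms (i + 1)"
  shows "face_perm ms x =
    (if x = partial_sum ms (i + 1) then partial_sum ms i + 1 else x + 1)"
proof -
  let ?c = "\<lambda>i. [partial_sum ms i + 1 ..< partial_sum ms (i + 1) + 1]"
  have disj: "set (?c k) \<inter> set (?c i) = {}" if "k \<noteq> i" for k
  proof -
    have "k + 1 \<le> i \<or> i + 1 \<le> k" using that by linarith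
    then have "partial_sum ms (k + 1) \<le> partial_sum ms i \<or>
        partial_sum ms (i + 1) \<le> partial_sum ms k"
      using partial_sum_mono by blast
    then show ?thesis by auto
  qed
  have "face_perm ms x = cycle_of_list (?c i) x"
    unfolding face_perm_def
    by (rule foldr_cycles_in[where c = ?c]) (use assms disj in auto)
  then show ?thesis
    using cycle_of_list_upt[of "partial_sum ms i + 1" x "partial_sum ms (i + 1) + 1"] assms
    by auto
qed

lemma foldr_cycles_permutes:
  assumes "\<And>i. i \<in> set is \<Longrightarrow> set (c i) \<subseteq> S"
  shows "foldr (\<lambda>i p. cycle_of_list (c i) \<circ> p) is id permutes S"
  using assms
proof (induction "is")
  case Nil
  show ?case by (simp add: permutes_id[unfolded id_def])
next
  case (Cons i "is")
  have "cycle_of_list (c i) permutes S"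
    by (rule permutes_subset[OF cycle_permutes]) (use Cons.prems in auto)
  moreover have "foldr (\<lambda>i p. cycle_of_list (c i) \<circ> p) is id permutes S"
    by (rule Cons.IH) (use Cons.prems in auto)
  ultimately have "cycle_of_list (c i) \<circ> foldr (\<lambda>i p. cycle_of_list (c i) \<circ> p) is id permutes S"
    by (rule permutes_compose[rotated])
  moreover have "foldr (\<lambda>i p. cycle_of_list (c i) \<circ> p) (i # is) id =
      cycle_of_list (c i) \<circ> foldr (\<lambda>i p. cycle_of_list (c i) \<circ> p) is id"
    by (rule ext) simp
  ultimately show ?case by metis
qed

lemma face_perm_permutes: "face_perm ms permutes {1..sum_list ms}"
  unfolding face_perm_def
proof (rule foldr_cycles_permutes)
  fix i assume "i \<in> set [0..<length ms]"
  then have "partial_sum ms (i + 1) \<le> sum_list ms"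
    using partial_sum_mono[of "i + 1" "length ms" ms] by (simp add: partial_sum_def)
  then show "set [partial_sum ms i + 1 ..< partial_sum ms (i + 1) + 1] \<subseteq> {1..sum_list ms}"
    by auto
qed

lemma finite_gluing_data: "finite (gluing_data N K)"
proof (rule finite_subset)
  show "gluing_data N K \<subseteq>
      {ms. set ms \<subseteq> {0..2 * N} \<and> length ms = K} \<times> {p. p permutes {1..2 * N}}"
    unfolding gluing_data_def using member_le_sum_list by fastforce
  show "finite ({ms. set ms \<subseteq> {0..2 * N} \<and> length ms = K} \<times> {p. p permutes {1..2 * N}})"
    by (intro finite_cartesian_product finite_lists_length_eq finite_permutations) auto
qed

end

theory Submission
  imports Defs
begin

text \<open>Fix the darts \<open>E \<times> {False, True}\<close> and the edge involution, and let instead the faces vary, as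
  words in the darts. A gluing datum with \<open>N\<close> edges and an equivariant labelling of \<open>{1..2 * N}\<close> by
  darts determine such a list of faces uniquely, and every datum has \<open>2 ^ N * fact N\<close> equivariant
  labellings; so it suffices to count lists of faces.

  Delete the root edge \<open>{r, s}\<close> of the first face, \<open>r\<close> being its first dart. If \<open>s\<close> lies in the
  other face \<open>c s d\<close>, the faces \<open>r a\<close> and \<open>c s d\<close> merge into \<open>a d c\<close>, and such a word arises from
  \<open>N (2 N - 1)\<close> choices of cuts. If \<open>s\<close> lies in the first face \<open>r a s b\<close>, this face splits into
  \<open>a\<close> and \<open>b\<close>, where an empty word stands for an isolated vertex. Neither changes the number of
  vertices, so in the second case the result is either connected of genus 0 with three faces, or has
  two components with genera adding up to 1, where \<open>a\<close> or \<open>b\<close> is alone in its component.\<close>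

section \<open>Cycles of permutations\<close>

text \<open>Deleting an edge from a gluing datum would force a renumbering of {1..2N}, and
  components would have to share out the numbers. With permanent edge names, one component lives on
  a subset \<open>F\<close> of \<open>E\<close> and the other on \<open>E - F\<close>, independently
  of each other. The choice of \<open>F\<close> costs a binomial coefficient, which cancels against
  the labelling factors \<open>2 ^ i * fact i\<close>, so that an ordinary convolution of
  \<open>eps\<close> remains; the 2N choices of the root dart turn the factor for N - 1 edges into
  the one for N edges. The delicate point is which component carries the handle. Knowing that the
  genera add up to 1 is not enough: negative or half-integral values must be excluded, so Euler's
  relation has to be solvable in natural numbers for each component. This is again proved by
  deleting edges. The factor 2 in the recursion records which of the two halves of the root face is
  alone in its component. The bound N - 3 arises because genus 1 is impossible with fewer than two
  edges, so the last two summands vanish.\<close>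

definition cycles_on :: "('a \<Rightarrow> 'a) \<Rightarrow> 'a set \<Rightarrow> nat" where
  "cycles_on p S = card (orbit p ` S)"

lemma cycles_on_empty [simp]: "cycles_on p {} = 0"
  by (simp add: cycles_on_def)

lemma cycles_on_cong:
  assumes "\<And>x. x \<in> S \<Longrightarrow> p x = q x" "p ` S \<subseteq> S"
  shows "cycles_on p S = cycles_on q S"
  unfolding cycles_on_def
  by (rule arg_cong[where f = card], rule image_cong[OF refl], rule orbit_cong0)
    (use assms in auto)

lemma cycles_on_pos:
  assumes "finite S" "S \<noteq> {}"
  shows "0 < cycles_on p S"
  using assms by (simp add: cycles_on_def card_gt_0_iff)

lemma permutes_self_in_orbit: "p permutes S \<Longrightarrow> finite S \<Longrightarrow> x \<in> orbit p x"
  by (meson permutation_permutes permutation_self_in_orbit)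

lemma orbit_subset_invariant:
  assumes "p ` S \<subseteq> S" "x \<in> S"
  shows "orbit p x \<subseteq> S"
proof
  fix y assume "y \<in> orbit p x"
  then show "y \<in> S" by induct (use assms in auto)
qed

lemma cycles_on_fixed:
  assumes "p permutes S" "finite S" "x \<in> S" "p x = x"
  shows "cycles_on p S = cycles_on p (S - {x}) + 1"
proof -
  have "orbit p x \<notin> orbit p ` (S - {x})"
  proof
    assume "orbit p x \<in> orbit p ` (S - {x})"
    then obtain y where y: "y \<in> S" "y \<noteq> x" "orbit p x = orbit p y" by auto
    then have "y \<in> {x}"
      using permutes_self_in_orbit[OF assms(1,2), of y] orbit_eq_singleton_iff[of p x] assms(4)
      by simp
    then show False using y by simp
  qed
  moreover have "orbit p ` S = insert (orbit p x) (orbit p ` (S - {x}))"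
    using assms(3) by auto
  ultimately show ?thesis
    using assms(2) by (simp add: cycles_on_def)
qed

text \<open>Composing with \<open>transpose s y\<close> inserts the fixed point \<open>s\<close> into the cycle of \<open>q\<close>
  through \<open>y\<close>, just before \<open>y\<close>.\<close>
lemma cycles_on_transpose_comp:
  assumes q: "q permutes S" "finite S" "q s = s" "s \<in> S" "y \<in> S" "y \<noteq> s"
  shows "cycles_on (transpose s y \<circ> q) S = cycles_on q (S - {s})"
proof -
  let ?p = "transpose s y \<circ> q"
  have neq: "q z \<noteq> s" if "z \<noteq> s" for z
    using that q(1,3) by (metis permutes_inj injD)
  have neqo: "z \<noteq> s" if "x \<noteq> s" "z \<in> orbit q x" for x z
    using that(2) by induct (use neq that(1) in auto)
  have ps: "?p s = y" using q by simp
  have pz: "?p z = (if q z = y then s else q z)" if "z \<noteq> s" for z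
    using neq[OF that] by (auto simp: transpose_def)
  \<comment> \<open>Inserting \<open>s\<close> into the cycle through \<open>y\<close> enlarges only
    the orbit that contains \<open>y\<close>. No orbit of \<open>q\<close> started off
    \<open>s\<close> contains \<open>s\<close>, so \<open>h\<close> is injective on these orbits and
    preserves their number.\<close>
  define h where "h = (\<lambda>A. if y \<in> A then insert s A else A)"
  have orb: "orbit ?p x = h (orbit q x)" if x: "x \<noteq> s" for x
  proof (intro equalityI subsetI)
    fix z assume "z \<in> orbit ?p x"
    then show "z \<in> h (orbit q x)"
    proof induct
      case base
      have "q x \<in> orbit q x" by (rule orbit.base)
      then show ?case using pz[OF x] by (auto simp: h_def)
    next
      case (step z)
      show ?case
      proof (cases "z = s")
        case True
        then have "y \<in> orbit q x" using step neqo[OF x] by (auto simp: h_def split: if_splits)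
        then show ?thesis using True ps by (simp add: h_def)
      next
        case False
        then have "z \<in> orbit q x" using step by (auto simp: h_def split: if_splits)
        then have "q z \<in> orbit q x" by (rule orbit.step)
        then show ?thesis using pz[OF False] by (auto simp: h_def)
      qed
    qed
  next
    have sub: "z \<in> orbit ?p x \<and> (z = y \<longrightarrow> s \<in> orbit ?p x)" if "z \<in> orbit q x" for z
      using that
    proof induct
      case base
      show ?case
      proof (cases "q x = y")
        case True
        then have "s \<in> orbit ?p x" using pz[OF x] orbit.base[of ?p x] by metis
        then show ?thesis using True ps orbit.step[of s ?p x] by metis
      next
        case False
        then show ?thesis using pz[OF x] orbit.base[of ?p x] by metis
      qed
    next
      case (step z)
      have zs: "z \<noteq> s" using neqo[OF x] step by simp
      show ?case
      proof (cases "q z = y")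
        case True
        then have "s \<in> orbit ?p x" using pz[OF zs] orbit.step[of z ?p x] step by metis
        then show ?thesis using True ps orbit.step[of s ?p x] by metis
      next
        case False
        then show ?thesis using pz[OF zs] orbit.step[of z ?p x] step by metis
      qed
    qed
    fix z assume "z \<in> h (orbit q x)"
    then show "z \<in> orbit ?p x" using sub by (auto simp: h_def split: if_splits)
  qed
  have "?p permutes S"
    using q by (intro permutes_compose permutes_swap_id) auto
  \<comment> \<open>Since \<open>s\<close> is mapped to \<open>y\<close>, both lie in one orbit, and
    dropping \<open>s\<close> from the carrier loses no orbit.\<close>
  then have "orbit ?p s = orbit ?p y"
    using permutation_orbit_step[of ?p s] ps q(2) permutation_permutes by metis
  then have "orbit ?p ` S = orbit ?p ` (S - {s})"
    using q by auto
  also have "\<dots> = h ` orbit q ` (S - {s})"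
    unfolding image_image using orb by (intro image_cong) auto
  also have "card \<dots> = card (orbit q ` (S - {s}))"
  proof (rule card_image, rule inj_onI)
    fix A B assume "A \<in> orbit q ` (S - {s})" "B \<in> orbit q ` (S - {s})" "h A = h B"
    moreover have "s \<notin> A" if "A \<in> orbit q ` (S - {s})" for A
      using that neqo by blast
    ultimately show "A = B"
      unfolding h_def by (metis insert_ident insertI1)
  qed
  finally show ?thesis by (simp add: cycles_on_def)
qed

lemma cycles_on_Un:
  assumes "finite A" "finite B" "A \<inter> B = {}" "p ` A \<subseteq> A" "p ` B \<subseteq> B"
  shows "cycles_on p (A \<union> B) = cycles_on p A + cycles_on p B"
proof -
  have "orbit p ` A \<inter> orbit p ` B = {}"
  proof -
    have False if "x \<in> A" "y \<in> B" "orbit p x = orbit p y" for x y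
      using orbit_subset_invariant[OF assms(4) that(1)] orbit_subset_invariant[OF assms(5) that(2)]
        that(3) orbit_nonempty[of p x] assms(3) by blast
    then show ?thesis by blast
  qed
  then show ?thesis
    using assms by (simp add: cycles_on_def image_Un card_Un_disjoint)
qed

lemma cycles_on_conj:
  assumes "bij_betw f A B" "finite A" "p permutes A" "\<And>x. x \<in> A \<Longrightarrow> q (f x) = f (p x)"
  shows "cycles_on q B = cycles_on p A"
proof -
  have orb: "orbit q (f x) = f ` orbit p x" if "x \<in> A" for x
  proof (rule orbit_inverse[symmetric])
    show "x \<in> orbit p x" using assms permutes_self_in_orbit by metis
    show "q (f y) = f (p y)" if "y \<in> orbit p x" for y
      using that \<open>x \<in> A\<close> permutes_orbit_subset[OF assms(3)] assms(4) by blast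
  qed
  have "orbit q ` B = (\<lambda>X. f ` X) ` orbit p ` A"
    using assms(1) orb unfolding bij_betw_def by force
  also have "card \<dots> = card (orbit p ` A)"
  proof (rule card_image, rule inj_onI)
    fix X Y assume "X \<in> orbit p ` A" "Y \<in> orbit p ` A" "f ` X = f ` Y"
    moreover have "Z \<subseteq> A" if "Z \<in> orbit p ` A" for Z
      using that permutes_orbit_subset[OF assms(3)] by blast
    ultimately show "X = Y"
      using assms(1) by (metis bij_betw_def inj_on_image_eq_iff)
  qed
  finally show ?thesis by (simp add: cycles_on_def)
qed

section \<open>Products of cycles given by words\<close>

definition faces_perm :: "'a list list \<Rightarrow> 'a \<Rightarrow> 'a" where
  "faces_perm fs = foldr (\<lambda>f p. cycle_of_list f \<circ> p) fs id"

lemma faces_perm_Nil [simp]: "faces_perm [] = id"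
  by (simp add: faces_perm_def)

lemma faces_perm_Cons [simp]: "faces_perm (f # fs) = cycle_of_list f \<circ> faces_perm fs"
  by (simp add: faces_perm_def)

lemma faces_perm_append: "faces_perm (fs @ gs) = faces_perm fs \<circ> faces_perm gs"
  by (induction fs) (simp_all add: comp_assoc)

lemma faces_perm_permutes: "faces_perm fs permutes set (concat fs)"
proof (induction fs)
  case Nil
  show ?case by (simp add: permutes_id[unfolded id_def] id_def)
next
  case (Cons f fs)
  have "cycle_of_list f permutes set (concat (f # fs))"
    by (rule permutes_subset[OF cycle_permutes]) auto
  moreover have "faces_perm fs permutes set (concat (f # fs))"
    by (rule permutes_subset[OF Cons]) auto
  ultimately show ?case
    unfolding faces_perm_Cons by (rule permutes_compose[rotated])
qed

lemma faces_perm_outside: "x \<notin> set (concat fs) \<Longrightarrow> faces_perm fs x = x"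
  using faces_perm_permutes permutes_not_in by metis

lemma faces_perm_swap:
  assumes "distinct (concat (f # g # fs))"
  shows "faces_perm (f # g # fs) = faces_perm (g # f # fs)"
  using cycles_commute[of f g] assms by (simp add: comp_assoc[symmetric] Int_Un_distrib)

text \<open>\<open>cycle_of_list\<close> is the product of the transpositions of neighbouring
  letters, from left to right. The product can be cut at any letter, which then belongs to both
  factors.\<close>

lemma cycle_of_list_append:
  "cycle_of_list (a @ x # b) = cycle_of_list (a @ [x]) \<circ> cycle_of_list (x # b)"
proof (induction a rule: cycle_of_list.induct)
  case (1 i j cs)
  then show ?case by (simp add: comp_assoc)
next
  case "2_1"
  show ?case by simp
next
  case ("2_2" v)
  show ?case by simp
qed

text \<open>Conjugating a cycle by itself applies it to every letter of its word, which rotates the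
  word by one place, but leaves the permutation as it is.\<close>

lemma cycle_of_list_rotate:
  assumes "distinct (a @ b)"
  shows "cycle_of_list (a @ b) = cycle_of_list (b @ a)"
proof -
  have rot1: "cycle_of_list (rotate1 l) = cycle_of_list l" if "distinct l" for l :: "'a list"
  proof -
    let ?c = "cycle_of_list l"
    have b: "bij ?c" by (simp add: permutation_bijective permutation_of_cycle)
    have "cycle_of_list (rotate1 l) = ?c \<circ> ?c \<circ> inv' ?c"
      using conjugation_of_cycle[OF that b] cyclic_rotation[OF that, of 1]
      by (simp add: rotate1_def)
    also have "\<dots> = ?c"
      using b by (simp add: comp_assoc surj_iff[THEN iffD1, OF bij_is_surj])
    finally show ?thesis .
  qed
  have "cycle_of_list (rotate n l) = cycle_of_list l" if "distinct l" for l :: "'a list" and n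
    by (induction n) (simp_all add: rot1 that)
  then show ?thesis using rotate_append[of a b] assms by metis
qed

lemma cycle_of_list_snoc:
  "distinct (a @ [x]) \<Longrightarrow> cycle_of_list (a @ [x]) = cycle_of_list (x # a)"
  using cycle_of_list_rotate[of a "[x]"] by simp

text \<open>Multiplying a cycle by the transposition of two of its letters cuts it in two. The
  transposition acts first, so \<open>r\<close> continues with the successor of \<open>s\<close>;
  this is why \<open>r\<close> goes with \<open>b\<close> and \<open>s\<close> with
  \<open>a\<close>.\<close>

lemma cycle_of_list_split:
  assumes "distinct (r # a @ s # b)"
  shows "cycle_of_list (r # a @ s # b) \<circ> transpose r s = cycle_of_list (s # a) \<circ> cycle_of_list (r # b)"
proof -
  have "cycle_of_list (r # a @ s # b) = cycle_of_list (a @ s # b @ [r])"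
    using cycle_of_list_rotate[of "[r]" "a @ s # b"] assms by simp
  also have "\<dots> = cycle_of_list (a @ [s]) \<circ> cycle_of_list (s # b @ [r])"
    by (rule cycle_of_list_append)
  also have "cycle_of_list (s # b @ [r]) = cycle_of_list (b @ [r, s])"
    using cycle_of_list_rotate[of "[s]" "b @ [r]"] assms by auto
  also have "\<dots> = cycle_of_list (b @ [r]) \<circ> transpose r s"
    using cycle_of_list_append[of b r "[s]"] by simp
  finally show ?thesis
    using cycle_of_list_snoc[of a s] cycle_of_list_snoc[of b r] assms
    by (auto simp: comp_assoc)
qed

text \<open>This is \<open>cycle_of_list_split\<close> with \<open>r\<close> and \<open>s\<close>
  exchanged, read backwards: the transposition is its own inverse.\<close>

lemma cycle_of_list_merge:
  assumes "distinct (r # a @ s # b)"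
  shows "cycle_of_list (r # a) \<circ> cycle_of_list (s # b) \<circ> transpose r s = cycle_of_list (s # a @ r # b)"
proof -
  have "cycle_of_list (s # a @ r # b) \<circ> transpose s r = cycle_of_list (r # a) \<circ> cycle_of_list (s # b)"
    by (rule cycle_of_list_split) (use assms in auto)
  then show ?thesis by (metis comp_assoc transpose_comp_involutory transpose_commute comp_id)
qed

text \<open>Injectivity is asked on \<open>S\<close> only, because a labelling of
  \<open>{1..2 * N}\<close> by darts is controlled only there.\<close>

lemma cycle_of_list_map:
  assumes "inj_on f S" "set xs \<subseteq> S" "x \<in> S"
  shows "cycle_of_list (map f xs) (f x) = f (cycle_of_list xs x)"
  using assms(2)
proof (induction xs rule: cycle_of_list.induct)
  case (1 i j cs)
  let ?z = "cycle_of_list (j # cs) x"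
  have "?z \<in> S"
    using permutes_in_image[OF cycle_permutes, of "j # cs" x] id_outside_supp[of x "j # cs"] 1(2) assms(3)
    by (cases "x \<in> set (j # cs)") auto
  then have "transpose (f i) (f j) (f ?z) = f (transpose i j ?z)"
    using assms(1) 1(2) by (auto simp: transpose_def inj_on_eq_iff)
  then show ?case using 1 by simp
qed simp_all

lemma faces_perm_map:
  assumes "inj_on f S" "set (concat fs) \<subseteq> S" "x \<in> S"
  shows "faces_perm (map (map f) fs) (f x) = f (faces_perm fs x)"
  using assms(2)
proof (induction fs)
  case (Cons g fs)
  have "faces_perm fs x \<in> S"
    using permutes_in_image[OF permutes_subset[OF faces_perm_permutes], of fs S x] Cons.prems assms(3)
    by auto
  then show ?case using Cons cycle_of_list_map[OF assms(1), of g] by simp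
qed simp

section \<open>Maps as lists of faces\<close>

type_synonym dart = "nat \<times> bool"

definition opp :: "dart \<Rightarrow> dart" where
  "opp d = (fst d, \<not> snd d)"

text \<open>Cut down to \<open>E\<close> so that it permutes the darts of \<open>E\<close> and is
  the identity elsewhere; adding an edge then means one more transposition as a factor.\<close>

definition opp_on :: "nat set \<Rightarrow> dart \<Rightarrow> dart" where
  "opp_on E d = (if fst d \<in> E then opp d else d)"

text \<open>The order of the list numbers the faces and the first letter of each word marks its
  distinguished edge, so no further data are needed.\<close>

definition covers :: "nat set \<Rightarrow> dart list list \<Rightarrow> bool" where
  "covers E fs \<longleftrightarrow> distinct (concat fs) \<and> set (concat fs) = E \<times> UNIV"

text \<open>An empty face stands for the map with one vertex and no edge.\<close>
definition vertices :: "nat set \<Rightarrow> dart list list \<Rightarrow> nat" where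
  "vertices E fs = cycles_on (faces_perm fs \<circ> opp_on E) (E \<times> UNIV) + count_list fs []"

lemma fst_opp [simp]: "fst (opp d) = fst d"
  and opp_opp [simp]: "opp (opp d) = d"
  and opp_neq [simp]: "opp d \<noteq> d" "d \<noteq> opp d"
  by (cases d; simp add: opp_def)+

lemma fst_eq_iff_opp: "fst x = fst y \<longleftrightarrow> x = y \<or> x = opp y"
  by (cases x; cases y; auto simp: opp_def)

lemma opp_on_permutes: "opp_on E permutes E \<times> UNIV"
proof (rule bij_imp_permutes)
  show "bij_betw (opp_on E) (E \<times> UNIV) (E \<times> UNIV)"
    by (rule bij_betw_byWitness[where f' = "opp_on E"]) (auto simp: opp_on_def opp_def)
  show "opp_on E x = x" if "x \<notin> E \<times> UNIV" for x
    using that by (auto simp: opp_on_def mem_Times_iff)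
qed

lemma opp_on_insert:
  assumes "fst r \<notin> E"
  shows "opp_on (insert (fst r) E) = transpose r (opp r) \<circ> opp_on E"
proof
  fix x
  consider "x = r" | "x = opp r" | "fst x \<noteq> fst r" by (metis fst_eq_iff_opp)
  then show "opp_on (insert (fst r) E) x = (transpose r (opp r) \<circ> opp_on E) x"
  proof cases
    case 3
    then have "opp x \<noteq> r" "opp x \<noteq> opp r" "x \<noteq> r" "x \<noteq> opp r" by (metis fst_opp)+
    then show ?thesis using 3 by (simp add: opp_on_def)
  qed (use assms in \<open>simp_all add: opp_on_def\<close>)
qed

lemma insert_Times_UNIV:
  "insert (fst r) E \<times> UNIV = insert r (insert (opp r) (E \<times> (UNIV :: bool set)))"
proof -
  have "{fst r} \<times> (UNIV :: bool set) = {r, opp r}"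
    by (cases r) (auto simp: opp_def)
  moreover have "insert (fst r) E \<times> (UNIV :: bool set) = {fst r} \<times> UNIV \<union> E \<times> UNIV"
    by auto
  ultimately show ?thesis by simp
qed

lemma dart_notin_Times:
  assumes "fst r \<notin> E"
  shows "r \<notin> E \<times> UNIV" "opp r \<notin> E \<times> UNIV"
  using assms by (auto simp: mem_Times_iff)

lemma insert_Times_UNIV_Diff:
  assumes "fst r \<notin> E"
  shows "insert (fst r) E \<times> UNIV - {opp r} - {r} = E \<times> (UNIV :: bool set)"
proof -
  have "insert r (insert s X) - {s} - {r} = X" if "r \<notin> X" "s \<notin> X" for r s and X :: "dart set"
    using that by blast
  then show ?thesis
    unfolding insert_Times_UNIV using dart_notin_Times[OF assms] .
qed

lemma insert_Times_UNIV_subset: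
  assumes "fst r \<notin> E"
  shows "E \<times> (UNIV :: bool set) \<subseteq> insert (fst r) E \<times> UNIV"
    "r \<in> insert (fst r) E \<times> UNIV" "opp r \<in> insert (fst r) E \<times> UNIV"
    "E \<times> (UNIV :: bool set) \<subseteq> insert (fst r) E \<times> UNIV - {opp r}"
proof -
  show "E \<times> (UNIV :: bool set) \<subseteq> insert (fst r) E \<times> UNIV - {opp r}"
    using dart_notin_Times(2)[OF assms] by (intro subset_Diff_insert[THEN iffD2] conjI) auto
qed (auto simp: mem_Times_iff)

section \<open>Dart sets and vertex numbers under splitting and merging of faces\<close>

lemma covers_swap: "covers E (f # g # fs) \<longleftrightarrow> covers E (g # f # fs)"
  unfolding covers_def by auto

lemma covers_append:
  assumes "covers E fs" "covers F gs" "E \<inter> F = {}"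
  shows "covers (E \<union> F) (fs @ gs)"
  using assms unfolding covers_def by auto

text \<open>With both darts of the deleted edge put in front, \<open>covers_split\<close> and
  \<open>covers_merge\<close> only compare two words that are rearrangements of each other.\<close>

lemma covers_iff_insert:
  assumes "fst r \<notin> E"
  shows "covers E fs \<longleftrightarrow> distinct (r # opp r # concat fs)
    \<and> set (r # opp r # concat fs) = insert (fst r) E \<times> UNIV" (is "_ \<longleftrightarrow> ?d \<and> ?s")
proof
  assume "covers E fs"
  then show "?d \<and> ?s"
    using dart_notin_Times[OF assms] unfolding covers_def insert_Times_UNIV by simp
next
  assume a: "?d \<and> ?s"
  then have "set (concat fs) = set (r # opp r # concat fs) - {opp r} - {r}"
    by auto
  then show "covers E fs"
    using a insert_Times_UNIV_Diff[OF assms] unfolding covers_def by simp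
qed

lemma covers_split:
  assumes "fst r \<notin> E"
  shows "covers (insert (fst r) E) ((r # a @ opp r # b) # fs) \<longleftrightarrow> covers E (a # b # fs)"
proof -
  let ?l = "concat ((r # a @ opp r # b) # fs)" and ?l' = "r # opp r # concat (a # b # fs)"
  have "distinct ?l \<longleftrightarrow> distinct ?l'" "set ?l = set ?l'" by auto
  then show ?thesis
    unfolding covers_iff_insert[OF assms] covers_def[of "insert (fst r) E"] by (simp only:)
qed

lemma covers_merge:
  assumes "fst r \<notin> E"
  shows "covers (insert (fst r) E) ((r # a) # (c @ opp r # d) # fs) \<longleftrightarrow> covers E ((a @ d @ c) # fs)"
proof -
  let ?l = "concat ((r # a) # (c @ opp r # d) # fs)" and ?l' = "r # opp r # concat ((a @ d @ c) # fs)"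
  have "distinct ?l \<longleftrightarrow> distinct ?l'" "set ?l = set ?l'" by auto
  then show ?thesis
    unfolding covers_iff_insert[OF assms] covers_def[of "insert (fst r) E"] by (simp only:)
qed

lemma vertices_swap:
  assumes "covers E (f # g # fs)"
  shows "vertices E (f # g # fs) = vertices E (g # f # fs)"
  using faces_perm_swap[of f g fs] assms unfolding covers_def vertices_def by simp

lemma vertices_rotate:
  assumes "covers E (gs @ (a @ b) # fs)"
  shows "vertices E (gs @ (a @ b) # fs) = vertices E (gs @ (b @ a) # fs)"
proof -
  have "distinct (a @ b)" using assms unfolding covers_def by auto
  from cycle_of_list_rotate[OF this] show ?thesis
    by (auto simp: vertices_def faces_perm_append)
qed

text \<open>The head \<open>x\<close> is fixed by all other factors, so the leading transposition
  merely inserts it into the cycle through the next letter. If there is no next letter,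
  \<open>x\<close> is a cycle of its own; the summand 1 then pays for the isolated vertex of the
  face that becomes empty.\<close>

lemma cycles_on_cycle_Cons:
  assumes "distinct (x # a)" "set a \<subseteq> S" "x \<in> S" "p permutes S" "p x = x" "finite S"
  shows "cycles_on (cycle_of_list (x # a) \<circ> p) S
    = cycles_on (cycle_of_list a \<circ> p) (S - {x}) + (if a = [] then 1 else 0)"
proof (cases a)
  case Nil
  then show ?thesis using cycles_on_fixed[OF assms(4,6,3,5)] by simp
next
  case (Cons y b)
  have "cycle_of_list (x # a) = transpose x y \<circ> cycle_of_list a"
    using Cons by simp
  moreover have "cycles_on (transpose x y \<circ> (cycle_of_list a \<circ> p)) S
      = cycles_on (cycle_of_list a \<circ> p) (S - {x})"
  proof (rule cycles_on_transpose_comp)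
    show "cycle_of_list a \<circ> p permutes S"
      using permutes_subset[OF cycle_permutes assms(2)] assms(4) by (rule permutes_compose[rotated])
    show "(cycle_of_list a \<circ> p) x = x"
      using assms by (simp add: id_outside_supp)
  qed (use assms Cons in auto)
  ultimately show ?thesis using Cons by (simp add: comp_assoc)
qed

lemma faces_perm_comp_opp_on_permutes:
  assumes "set (concat fs) \<subseteq> E \<times> UNIV"
  shows "faces_perm fs \<circ> opp_on E permutes E \<times> UNIV"
  using permutes_subset[OF faces_perm_permutes assms] opp_on_permutes
  by (rule permutes_compose[rotated])

lemma faces_perm_comp_transpose:
  assumes "r \<notin> set (concat fs)" "s \<notin> set (concat fs)"
  shows "faces_perm fs \<circ> transpose r s = transpose r s \<circ> faces_perm fs"
proof -
  have f: "faces_perm fs r = r" "faces_perm fs s = s"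
    using assms faces_perm_outside by metis+
  have "inj (faces_perm fs)" using faces_perm_permutes permutes_inj by metis
  then have "faces_perm fs x = r \<longleftrightarrow> x = r" "faces_perm fs x = s \<longleftrightarrow> x = s" for x
    using f by (metis injD)+
  then show ?thesis using f by (auto simp: fun_eq_iff transpose_def)
qed

text \<open>The new edge contributes \<open>transpose r (opp r)\<close>, which commutes with the
  other faces and cuts the root cycle into \<open>opp r # a\<close> and \<open>r # b\<close>. Each
  of the two darts then stands at the head of its own cycle and can be removed.\<close>

lemma vertices_split:
  assumes "fst r \<notin> E" "finite E" "covers (insert (fst r) E) ((r # a @ opp r # b) # fs)"
  shows "vertices (insert (fst r) E) ((r # a @ opp r # b) # fs) = vertices E (a # b # fs)"
proof -
  let ?D = "insert (fst r) E \<times> (UNIV :: bool set)"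
  let ?s = "opp r"
  define q where "q = faces_perm fs \<circ> opp_on E"
  have dist: "distinct (r # a @ ?s # b)"
    and notin: "r \<notin> set (concat fs)" "?s \<notin> set (concat fs)"
    using assms(3) unfolding covers_def by auto
  have c: "covers E (a # b # fs)" using covers_split assms by blast
  then have sub: "set (concat fs) \<subseteq> E \<times> UNIV" "set a \<subseteq> E \<times> UNIV" "set b \<subseteq> E \<times> UNIV"
    and disj: "set a \<inter> set b = {}" "distinct a" "distinct b"
    unfolding covers_def by auto
  have qp: "q permutes E \<times> UNIV"
    unfolding q_def by (rule faces_perm_comp_opp_on_permutes[OF sub(1)])
  have ED: "E \<times> (UNIV :: bool set) \<subseteq> ?D" "r \<in> ?D" "?s \<in> ?D" "E \<times> (UNIV :: bool set) \<subseteq> ?D - {?s}"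
    using insert_Times_UNIV_subset[OF assms(1)] .
  have rE: "r \<notin> E \<times> UNIV" "?s \<notin> E \<times> UNIV"
    using dart_notin_Times[OF assms(1)] .
  have fin: "finite ?D" using assms(2) by simp
  have pc: "cycle_of_list l permutes E \<times> UNIV" if "set l \<subseteq> E \<times> UNIV" for l :: "dart list"
    by (rule permutes_subset[OF cycle_permutes that])
  have "faces_perm ((r # a @ ?s # b) # fs) \<circ> opp_on (insert (fst r) E)
      = cycle_of_list (r # a @ ?s # b) \<circ> (faces_perm fs \<circ> transpose r ?s) \<circ> opp_on E"
    unfolding opp_on_insert[OF assms(1)] by (simp only: faces_perm_Cons comp_assoc)
  also have "\<dots> = (cycle_of_list (r # a @ ?s # b) \<circ> transpose r ?s) \<circ> q"
    unfolding faces_perm_comp_transpose[OF notin] q_def by (simp only: comp_assoc)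
  also have "\<dots> = cycle_of_list (?s # a) \<circ> (cycle_of_list (r # b) \<circ> q)"
    unfolding cycle_of_list_split[OF dist] by (simp only: comp_assoc)
  finally have "cycles_on (faces_perm ((r # a @ ?s # b) # fs) \<circ> opp_on (insert (fst r) E)) ?D
      = cycles_on (cycle_of_list (?s # a) \<circ> (cycle_of_list (r # b) \<circ> q)) ?D"
    by simp
  also have "\<dots> = cycles_on (cycle_of_list a \<circ> (cycle_of_list (r # b) \<circ> q)) (?D - {?s})
      + (if a = [] then 1 else 0)"
  proof (rule cycles_on_cycle_Cons)
    show "cycle_of_list (r # b) \<circ> q permutes ?D"
      by (rule permutes_compose[OF permutes_subset[OF qp ED(1)] permutes_subset[OF cycle_permutes]])
        (use sub ED in auto)
    have "q ?s = ?s" by (rule permutes_not_in[OF qp rE(2)])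
    then show "(cycle_of_list (r # b) \<circ> q) ?s = ?s"
      using dist by (simp add: id_outside_supp)
  qed (use dist sub ED fin in auto)
  \<comment> \<open>The two cycles are disjoint; exchanging them brings \<open>r\<close>, the next
    letter to be removed, to the front.\<close>
  also have "cycle_of_list a \<circ> (cycle_of_list (r # b) \<circ> q) = cycle_of_list (r # b) \<circ> (cycle_of_list a \<circ> q)"
    using cycles_commute[of a "r # b"] dist by (auto simp: comp_assoc[symmetric])
  also have "cycles_on (cycle_of_list (r # b) \<circ> (cycle_of_list a \<circ> q)) (?D - {?s})
      = cycles_on (cycle_of_list b \<circ> (cycle_of_list a \<circ> q)) (?D - {?s} - {r})
      + (if b = [] then 1 else 0)"
  proof (rule cycles_on_cycle_Cons)
    show "cycle_of_list a \<circ> q permutes ?D - {?s}"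
      by (rule permutes_subset[OF permutes_compose[OF qp pc[OF sub(2)]] ED(4)])
    have "q r = r" by (rule permutes_not_in[OF qp rE(1)])
    then show "(cycle_of_list a \<circ> q) r = r"
      using dist by (simp add: id_outside_supp)
  qed (use dist sub ED fin in auto)
  also have "?D - {?s} - {r} = E \<times> UNIV"
    by (rule insert_Times_UNIV_Diff[OF assms(1)])
  also have "cycle_of_list b \<circ> (cycle_of_list a \<circ> q) = faces_perm (a # b # fs) \<circ> opp_on E"
    using cycles_commute[of a b] disj by (simp add: comp_assoc[symmetric] q_def)
  finally have cyc: "cycles_on (faces_perm ((r # a @ ?s # b) # fs) \<circ> opp_on (insert (fst r) E)) ?D
      = cycles_on (faces_perm (a # b # fs) \<circ> opp_on E) (E \<times> UNIV)
        + (if b = [] then 1 else 0) + (if a = [] then 1 else 0)" .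
  \<comment> \<open>Every cycle lost through an emptied word reappears as the vertex that this empty
    face stands for.\<close>
  have count: "count_list (a # b # fs) []
      = (if b = [] then 1 else 0) + ((if a = [] then 1 else 0) + count_list ((r # a @ ?s # b) # fs) [])"
    by simp
  show ?thesis
    unfolding vertices_def cyc count by (simp only: add.assoc)
qed

lemma vertices_merge:
  assumes "fst r \<notin> E" "finite E" "covers (insert (fst r) E) ((r # a) # (c @ opp r # d) # fs)"
  shows "vertices (insert (fst r) E) ((r # a) # (c @ opp r # d) # fs) = vertices E ((a @ d @ c) # fs)"
proof -
  let ?D = "insert (fst r) E \<times> (UNIV :: bool set)"
  let ?s = "opp r"
  \<comment> \<open>\<open>cycle_of_list_merge\<close> wants \<open>opp r\<close> at the head of the
    second face; after rotating it there, \<open>d @ c\<close> is the rest.\<close>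
  define b where "b = d @ c"
  define q where "q = faces_perm fs \<circ> opp_on E"
  have dist: "distinct (r # a @ ?s # b)"
    and notin: "r \<notin> set (concat fs)" "?s \<notin> set (concat fs)"
    using assms(3) unfolding covers_def b_def by auto
  have "covers E ((a @ d @ c) # fs)" using covers_merge assms by blast
  then have sub: "set (concat fs) \<subseteq> E \<times> UNIV" "set a \<subseteq> E \<times> UNIV" "set b \<subseteq> E \<times> UNIV"
    unfolding covers_def b_def by auto
  have qp: "q permutes E \<times> UNIV"
    unfolding q_def by (rule faces_perm_comp_opp_on_permutes[OF sub(1)])
  have ED: "E \<times> (UNIV :: bool set) \<subseteq> ?D" "r \<in> ?D" "?s \<in> ?D" "E \<times> (UNIV :: bool set) \<subseteq> ?D - {?s}"
    using insert_Times_UNIV_subset[OF assms(1)] .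
  have rE: "r \<notin> E \<times> UNIV" "?s \<notin> E \<times> UNIV"
    using dart_notin_Times[OF assms(1)] .
  have fin: "finite ?D" using assms(2) by simp
  have "faces_perm ((r # a) # (?s # b) # fs) \<circ> opp_on (insert (fst r) E)
      = cycle_of_list (r # a) \<circ> cycle_of_list (?s # b) \<circ> (faces_perm fs \<circ> transpose r ?s) \<circ> opp_on E"
    unfolding opp_on_insert[OF assms(1)] by (simp only: faces_perm_Cons comp_assoc)
  also have "\<dots> = (cycle_of_list (r # a) \<circ> cycle_of_list (?s # b) \<circ> transpose r ?s) \<circ> q"
    unfolding faces_perm_comp_transpose[OF notin] q_def by (simp only: comp_assoc)
  also have "\<dots> = cycle_of_list (?s # a @ r # b) \<circ> q"
    unfolding cycle_of_list_merge[OF dist] ..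
  finally have "cycles_on (faces_perm ((r # a) # (?s # b) # fs) \<circ> opp_on (insert (fst r) E)) ?D
      = cycles_on (cycle_of_list (?s # a @ r # b) \<circ> q) ?D"
    by simp
  \<comment> \<open>Here both darts lie in one cycle. Removing \<open>opp r\<close> leaves a word
    containing \<open>r\<close>, so a cycle can be lost only in the second removal, when
    \<open>a\<close>, \<open>c\<close> and \<open>d\<close> are all empty.\<close>
  also have "\<dots> = cycles_on (cycle_of_list (a @ r # b) \<circ> q) (?D - {?s})
      + (if a @ r # b = [] then 1 else 0)"
    by (rule cycles_on_cycle_Cons)
      (use dist sub ED fin permutes_subset[OF qp ED(1)] permutes_not_in[OF qp rE(2)] in auto)
  also have "cycle_of_list (a @ r # b) = cycle_of_list (r # b @ a)"
    using cycle_of_list_rotate[of a "r # b"] dist by auto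
  also have "cycles_on (cycle_of_list (r # b @ a) \<circ> q) (?D - {?s})
      = cycles_on (cycle_of_list (b @ a) \<circ> q) (?D - {?s} - {r})
      + (if b @ a = [] then 1 else 0)"
    by (rule cycles_on_cycle_Cons)
      (use dist sub ED fin permutes_subset[OF qp ED(4)] permutes_not_in[OF qp rE(1)] in auto)
  also have "?D - {?s} - {r} = E \<times> UNIV"
    by (rule insert_Times_UNIV_Diff[OF assms(1)])
  also have "cycle_of_list (b @ a) = cycle_of_list (a @ b)"
    using cycle_of_list_rotate[of b a] dist by auto
  finally have cyc: "cycles_on (faces_perm ((r # a) # (?s # b) # fs) \<circ> opp_on (insert (fst r) E)) ?D
      = cycles_on (faces_perm ((a @ b) # fs) \<circ> opp_on E) (E \<times> UNIV) + (if b @ a = [] then 1 else 0)"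
    by (simp only: q_def faces_perm_Cons comp_assoc append_is_Nil_conv list.distinct simp_thms if_False add_0_right)
  have count: "count_list ((a @ b) # fs) []
      = (if b @ a = [] then 1 else 0) + count_list ((r # a) # (?s # b) # fs) []"
    by simp
  have "vertices (insert (fst r) E) ((r # a) # (?s # b) # fs) = vertices E ((a @ b) # fs)"
    unfolding vertices_def cyc count by (simp only: add.assoc)
  moreover have "vertices (insert (fst r) E) ((r # a) # (c @ ?s # d) # fs)
      = vertices (insert (fst r) E) ((r # a) # (?s # b) # fs)"
    using vertices_rotate[of _ "[r # a]" c "?s # d" fs] assms(3) by (simp add: b_def)
  ultimately show ?thesis by (simp add: b_def)
qed

lemma vertices_append:
  assumes "covers E fs" "covers F gs" "E \<inter> F = {}" "finite E" "finite F"
  shows "vertices (E \<union> F) (fs @ gs) = vertices E fs + vertices F gs"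
proof -
  let ?p = "faces_perm (fs @ gs) \<circ> opp_on (E \<union> F)"
  have oE: "opp_on E x \<in> E \<times> UNIV" if "x \<in> E \<times> UNIV" for x
    using that by (auto simp: opp_on_def opp_def)
  have oF: "opp_on F x \<in> F \<times> UNIV" if "x \<in> F \<times> UNIV" for x
    using that by (auto simp: opp_on_def opp_def)
  have fE: "faces_perm fs permutes E \<times> UNIV" and fF: "faces_perm gs permutes F \<times> UNIV"
    using faces_perm_permutes[of fs] faces_perm_permutes[of gs] assms(1,2) by (simp_all add: covers_def)
  have e1: "?p x = (faces_perm fs \<circ> opp_on E) x" if "x \<in> E \<times> UNIV" for x
  proof -
    have "opp_on (E \<union> F) x = opp_on E x" using that by (auto simp: opp_on_def)
    moreover have "faces_perm gs (opp_on E x) = opp_on E x"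
      by (rule permutes_not_in[OF fF]) (use oE[OF that] assms(3) in auto)
    ultimately show ?thesis by (simp add: faces_perm_append)
  qed
  have e2: "?p x = (faces_perm gs \<circ> opp_on F) x" if "x \<in> F \<times> UNIV" for x
  proof -
    have "opp_on (E \<union> F) x = opp_on F x" using that by (auto simp: opp_on_def)
    moreover have "faces_perm gs (opp_on F x) \<in> F \<times> UNIV"
      using permutes_in_image[OF fF] oF[OF that] by simp
    then have "faces_perm fs (faces_perm gs (opp_on F x)) = faces_perm gs (opp_on F x)"
      by (intro permutes_not_in[OF fE]) (use assms(3) in auto)
    ultimately show ?thesis by (simp add: faces_perm_append)
  qed
  have i1: "?p ` (E \<times> UNIV) \<subseteq> E \<times> UNIV"
    using e1 oE permutes_in_image[OF fE] by (intro image_subsetI) (simp only: comp_apply)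
  have i2: "?p ` (F \<times> UNIV) \<subseteq> F \<times> UNIV"
    using e2 oF permutes_in_image[OF fF] by (intro image_subsetI) (simp only: comp_apply)
  have "cycles_on ?p (E \<times> UNIV \<union> F \<times> UNIV) = cycles_on ?p (E \<times> UNIV) + cycles_on ?p (F \<times> UNIV)"
    by (rule cycles_on_Un) (use assms i1 i2 in auto)
  moreover have "cycles_on ?p (E \<times> UNIV) = cycles_on (faces_perm fs \<circ> opp_on E) (E \<times> UNIV)"
    by (rule cycles_on_cong[OF e1 i1])
  moreover have "cycles_on ?p (F \<times> UNIV) = cycles_on (faces_perm gs \<circ> opp_on F) (F \<times> UNIV)"
    by (rule cycles_on_cong[OF e2 i2])
  moreover have "(E \<union> F) \<times> (UNIV :: bool set) = E \<times> UNIV \<union> F \<times> UNIV" by auto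
  ultimately show ?thesis by (simp add: vertices_def)
qed

text \<open>The last conjunct excludes the isolated vertices that empty faces stand for.\<close>
definition linked :: "nat set \<Rightarrow> dart list list \<Rightarrow> bool" where
  "linked E fs \<longleftrightarrow>
    (\<forall>A \<subseteq> E \<times> UNIV. opp ` A \<subseteq> A \<longrightarrow> (\<forall>f \<in> set fs. set f \<inter> A \<noteq> {} \<longrightarrow> set f \<subseteq> A) \<longrightarrow>
      A = {} \<or> A = E \<times> UNIV) \<and> (length fs = 1 \<or> [] \<notin> set fs)"

section \<open>Connectivity of two and three faces through shared edges\<close>

definition adjacent :: "dart list \<Rightarrow> dart list \<Rightarrow> bool" where
  "adjacent f g \<longleftrightarrow> (\<exists>x \<in> set f. opp x \<in> set g)"

lemma adjacent_sym: "adjacent f g \<longleftrightarrow> adjacent g f"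
  unfolding adjacent_def by (metis opp_opp)

lemma linkedI:
  assumes "\<And>A. A \<subseteq> E \<times> UNIV \<Longrightarrow> (\<And>x. x \<in> A \<Longrightarrow> opp x \<in> A) \<Longrightarrow>
      (\<And>f x y. f \<in> set fs \<Longrightarrow> x \<in> set f \<Longrightarrow> x \<in> A \<Longrightarrow> y \<in> set f \<Longrightarrow> y \<in> A) \<Longrightarrow>
      A = {} \<or> A = E \<times> UNIV"
    "length fs = 1 \<or> [] \<notin> set fs"
  shows "linked E fs"
  unfolding linked_def
proof (intro conjI allI impI)
  fix A assume "A \<subseteq> E \<times> UNIV" "opp ` A \<subseteq> A" "\<forall>f \<in> set fs. set f \<inter> A \<noteq> {} \<longrightarrow> set f \<subseteq> A"
  then show "A = {} \<or> A = E \<times> UNIV"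
    by (intro assms(1)) blast+
qed (rule assms(2))

lemma linked_single:
  assumes "covers E [f]"
  shows "linked E [f]"
  using assms unfolding linked_def covers_def by auto

text \<open>If \<open>f\<close> shared no edge with another face, its darts would form a nonempty
  closed set and hence be all darts, leaving none for the other faces, which are nonempty.\<close>

lemma linked_adjacent:
  assumes "linked E (f # fs)" "covers E (f # fs)" "fs \<noteq> []"
  shows "\<exists>g \<in> set fs. adjacent f g"
proof (rule ccontr)
  assume n: "\<not> (\<exists>g \<in> set fs. adjacent f g)"
  have ne: "f \<noteq> []" "[] \<notin> set fs" using assms(1,3) unfolding linked_def by auto
  have D: "set (concat (f # fs)) = E \<times> UNIV" using assms(2) by (simp add: covers_def)
  have "opp ` set f \<subseteq> set f"
  proof
    fix y assume "y \<in> opp ` set f"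
    then obtain x where x: "x \<in> set f" "y = opp x" by auto
    then have "x \<in> set (concat (f # fs))" by simp
    then have "y \<in> set (concat (f # fs))" unfolding D using x by (auto simp: opp_def)
    then show "y \<in> set f" using n x unfolding adjacent_def by auto
  qed
  moreover have "set g \<subseteq> set f" if "g \<in> set (f # fs)" "set g \<inter> set f \<noteq> {}" for g
    using that assms(2) unfolding covers_def by auto
  moreover have "set f \<subseteq> E \<times> UNIV" using D by auto
  ultimately have "set f = E \<times> UNIV"
    using assms(1) ne unfolding linked_def by (metis set_empty)
  moreover obtain g where "g \<in> set fs" using assms(3) by (cases fs) auto
  moreover have "g \<noteq> []" using ne \<open>g \<in> set fs\<close> by auto
  moreover have "hd g \<in> set (concat (f # fs))"
    using \<open>g \<in> set fs\<close> hd_in_set[OF \<open>g \<noteq> []\<close>] by auto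
  ultimately have "hd g \<in> set g \<and> hd g \<in> set f"
    unfolding D by simp
  then show False using \<open>g \<in> set fs\<close> assms(2) unfolding covers_def by auto
qed

lemma linked_swap: "linked E (f # g # fs) \<longleftrightarrow> linked E (g # f # fs)"
  unfolding linked_def by auto

lemma linked_rotate3: "linked E [f, g, h] \<longleftrightarrow> linked E [h, f, g]"
  unfolding linked_def by auto

lemma linked_pair:
  assumes "covers E [f, g]"
  shows "linked E [f, g] \<longleftrightarrow> adjacent f g"
proof
  assume "linked E [f, g]"
  then show "adjacent f g" using linked_adjacent[of E f "[g]"] assms by simp
next
  assume "adjacent f g"
  then obtain x where x: "x \<in> set f" "opp x \<in> set g" unfolding adjacent_def by auto
  have D: "set f \<union> set g = E \<times> UNIV" using assms by (simp add: covers_def)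
  show "linked E [f, g]"
  proof (rule linkedI)
    fix A assume A: "A \<subseteq> E \<times> UNIV" "\<And>x. x \<in> A \<Longrightarrow> opp x \<in> A"
      "\<And>h x y. h \<in> set [f, g] \<Longrightarrow> x \<in> set h \<Longrightarrow> x \<in> A \<Longrightarrow> y \<in> set h \<Longrightarrow> y \<in> A"
    show "A = {} \<or> A = E \<times> UNIV"
    proof (cases "A = {}")
      case False
      then obtain z where z: "z \<in> A" "z \<in> set f \<or> z \<in> set g" using A(1) D by blast
      then have "x \<in> A \<or> opp x \<in> A" using A(3)[of f z x] A(3)[of g z "opp x"] x by auto
      then have "x \<in> A" "opp x \<in> A" using A(2)[of x] A(2)[of "opp x"] by auto
      then have "set f \<subseteq> A" "set g \<subseteq> A" using A(3)[of f x] A(3)[of g "opp x"] x by auto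
      then show ?thesis using A(1) D by auto
    qed simp
  qed (use x in auto)
qed

text \<open>A graph on three vertices is connected as soon as no vertex is isolated, and this means
  that at least two of the three possible edges are present. Connectivity thus becomes a
  propositional condition, on which the later case distinction rests.\<close>

lemma linked_triple:
  assumes "covers E [f, g, h]"
  shows "linked E [f, g, h] \<longleftrightarrow>
    adjacent f g \<and> adjacent g h \<or> adjacent g h \<and> adjacent f h \<or> adjacent f h \<and> adjacent f g"
    (is "_ \<longleftrightarrow> ?R")
proof
  assume l: "linked E [f, g, h]"
  have l': "linked E [g, f, h]" "linked E [h, f, g]"
    using l linked_swap[of E f g "[h]"] linked_rotate3 by auto
  have c': "covers E [g, f, h]" "covers E [h, f, g]"
    using assms unfolding covers_def by auto
  have "adjacent f g \<or> adjacent f h"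
    using linked_adjacent[OF l assms] by simp
  moreover have "adjacent f g \<or> adjacent g h"
    using linked_adjacent[OF l'(1) c'(1)] adjacent_sym by auto
  moreover have "adjacent f h \<or> adjacent g h"
    using linked_adjacent[OF l'(2) c'(2)] adjacent_sym by auto
  ultimately show ?R by blast
next
  assume R: ?R
  have D: "set f \<union> set g \<union> set h = E \<times> UNIV" using assms by (auto simp: covers_def)
  show "linked E [f, g, h]"
  proof (rule linkedI)
    fix A assume A: "A \<subseteq> E \<times> UNIV" "\<And>x. x \<in> A \<Longrightarrow> opp x \<in> A"
      "\<And>k x y. k \<in> set [f, g, h] \<Longrightarrow> x \<in> set k \<Longrightarrow> x \<in> A \<Longrightarrow> y \<in> set k \<Longrightarrow> y \<in> A"
    have step: "set k \<subseteq> A \<longleftrightarrow> set l \<subseteq> A"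
      if kl: "adjacent k l" "k \<in> set [f, g, h]" "l \<in> set [f, g, h]" for k l
    proof -
      obtain x where x: "x \<in> set k" "opp x \<in> set l" using kl(1) unfolding adjacent_def by blast
      have "x \<in> A \<longleftrightarrow> opp x \<in> A" using A(2)[of x] A(2)[of "opp x"] by auto
      moreover have "set k \<subseteq> A \<longleftrightarrow> x \<in> A" using A(3)[of k x] kl x by auto
      moreover have "set l \<subseteq> A \<longleftrightarrow> opp x \<in> A" using A(3)[of l "opp x"] kl x by auto
      ultimately show ?thesis by blast
    qed
    show "A = {} \<or> A = E \<times> UNIV"
    proof (cases "A = {}")
      case False
      then obtain z where z: "z \<in> A" "z \<in> set f \<or> z \<in> set g \<or> z \<in> set h" using A(1) D by blast
      then have "set f \<subseteq> A \<or> set g \<subseteq> A \<or> set h \<subseteq> A"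
        using A(3)[of f z] A(3)[of g z] A(3)[of h z] by auto
      then have "set f \<subseteq> A \<and> set g \<subseteq> A \<and> set h \<subseteq> A"
        using R step[of f g] step[of g h] step[of f h] by auto
      then show ?thesis using A(1) D by blast
    qed simp
  next
    show "length [f, g, h] = 1 \<or> [] \<notin> set [f, g, h]"
      using R by (auto simp: adjacent_def)
  qed
qed

section \<open>Separation into components and Euler's relation with a natural genus\<close>

lemma covers_unlinked:
  assumes "covers E (fs @ gs)" "\<And>f g. f \<in> set fs \<Longrightarrow> g \<in> set gs \<Longrightarrow> \<not> adjacent f g"
  obtains F where "F \<subseteq> E" "covers F fs" "covers (E - F) gs"
proof
  \<comment> \<open>No edge leads out of \<open>fs\<close>, so its darts are closed under
    \<open>opp\<close> and are all the darts of the edges occurring in it.\<close>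
  let ?F = "fst ` set (concat fs)"
  have D: "set (concat fs) \<union> set (concat gs) = E \<times> UNIV" "set (concat fs) \<inter> set (concat gs) = {}"
    "distinct (concat fs)" "distinct (concat gs)"
    using assms(1) unfolding covers_def by auto
  have o: "opp x \<in> set (concat fs)" if x: "x \<in> set (concat fs)" for x
  proof -
    have "x \<in> E \<times> UNIV" unfolding D(1)[symmetric] using x by (rule UnI1)
    then have "opp x \<in> set (concat fs) \<union> set (concat gs)" unfolding D(1) by (auto simp: opp_def)
    moreover have "opp x \<notin> set (concat gs)" using assms(2) x unfolding adjacent_def by auto
    ultimately show ?thesis by simp
  qed
  have F: "set (concat fs) = ?F \<times> UNIV"
  proof (rule subset_antisym)
    show "?F \<times> UNIV \<subseteq> set (concat fs)"
    proof
      fix y :: dart assume "y \<in> ?F \<times> UNIV"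
      then obtain x where "x \<in> set (concat fs)" "fst y = fst x" unfolding mem_Times_iff by blast
      then show "y \<in> set (concat fs)" using o fst_eq_iff_opp by metis
    qed
  next
    show "set (concat fs) \<subseteq> ?F \<times> UNIV"
      by (intro subsetI mem_Times_iff[THEN iffD2] conjI imageI UNIV_I)
  qed
  have "set (concat fs) \<subseteq> E \<times> UNIV" using D(1) by blast
  then show "?F \<subseteq> E" by auto
  show "covers ?F fs" using F D by (simp add: covers_def)
  have "set (concat gs) = E \<times> UNIV - ?F \<times> UNIV" using D F by blast
  also have "\<dots> = (E - ?F) \<times> UNIV" by auto
  finally show "covers (E - ?F) gs" using D unfolding covers_def by blast
qed

text \<open>An edge between two faces is deleted by merging them, which removes one edge and one
  face but no vertex. The first face is rotated because \<open>vertices_merge\<close> expects the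
  dart at its head.\<close>

lemma covers_pair_linkedE:
  assumes "covers E [f, g]" "adjacent f g" "finite E"
  obtains F h where "finite F" "card E = card F + 1" "covers F [h]" "vertices E [f, g] = vertices F [h]"
proof -
  obtain x where x: "x \<in> set f" "opp x \<in> set g" using assms unfolding adjacent_def by auto
  obtain a b where f: "f = a @ x # b" using x split_list by metis
  obtain c d where g: "g = c @ opp x # d" using x split_list by metis
  define F where "F = E - {fst x}"
  have "x \<in> E \<times> UNIV" using assms(1) x by (auto simp: covers_def)
  then have E: "E = insert (fst x) F" "fst x \<notin> F" "finite F"
    using assms(3) unfolding F_def by auto
  have c: "covers (insert (fst x) F) [x # b @ a, c @ opp x # d]"
    using assms(1) unfolding f g E(1) covers_def by auto
  have "vertices E [f, g] = vertices (insert (fst x) F) [x # b @ a, c @ opp x # d]"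
    using vertices_rotate[of E "[]" a "x # b" "[g]"] assms(1) E unfolding f g by simp
  then show ?thesis
    using that[of F "(b @ a) @ d @ c"] covers_merge[OF E(2), of "b @ a" c d "[]"]
      vertices_merge[OF E(2,3) c] c E by auto
qed

lemma covers_ConsE:
  assumes "covers E (f # fs)" "f \<noteq> []"
  obtains r w F where "f = r # w" "E = insert (fst r) F" "fst r \<notin> F" "fst r \<in> E" "F = E - {fst r}"
    "opp r \<in> set w \<or> opp r \<in> set (concat fs)"
proof -
  obtain r w where f: "f = r # w" using assms(2) by (cases f) auto
  have "r \<in> E \<times> UNIV" using assms(1) f by (auto simp: covers_def)
  then have "fst r \<in> E" by auto
  have "opp r \<in> set (concat (f # fs))"
    using assms(1) \<open>fst r \<in> E\<close> unfolding covers_def by (simp add: mem_Times_iff)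
  then have "opp r \<in> set w \<or> opp r \<in> set (concat fs)"
    using f by auto
  then show ?thesis using that[of r w "E - {fst r}"] f \<open>fst r \<in> E\<close> by auto
qed

text \<open>The content is that \<open>g\<close> is a natural number: the Euler characteristic has
  the right parity and is not too large. Deleting the root edge splits the only face; its halves
  either share an edge, and merging along it makes one face again, or they lie in separate
  components to which induction applies.\<close>

lemma genus_single:
  assumes "finite E" "covers E [f]"
  shows "\<exists>g. vertices E [f] + 2 * g = card E + 1"
  using assms
proof (induction "card E" arbitrary: E f rule: less_induct)
  case less
  show ?case
  proof (cases "f = []")
    case True
    then have "E = {}" using less.prems by (auto simp: covers_def)
    then show ?thesis using True by (simp add: vertices_def)
  next
    case False
    obtain r w F where r: "f = r # w" "E = insert (fst r) F" "fst r \<notin> F" "opp r \<in> set w \<or> opp r \<in> set (concat [])"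
      using covers_ConsE[OF less.prems(2) False] .
    then have "opp r \<in> set w" by simp
    then obtain a b where w: "w = a @ opp r # b" using split_list by metis
    have finF: "finite F" using less.prems r by simp
    have c: "covers F [a, b]" and V: "vertices E [f] = vertices F [a, b]"
      using covers_split[OF r(3)] vertices_split[OF r(3) finF] less.prems r w by auto
    have cE: "card E = card F + 1" using r finF by simp
    show ?thesis
    proof (cases "adjacent a b")
      case True
      obtain G h where G: "finite G" "card F = card G + 1" "covers G [h]"
        "vertices F [a, b] = vertices G [h]"
        using covers_pair_linkedE[OF c True finF] .
      obtain g where "vertices G [h] + 2 * g = card G + 1"
        using less.hyps[of G h] G cE by auto
      \<comment> \<open>From one face to one face, two edges and no vertex have disappeared: this is
        one handle.\<close>
      then have "vertices E [f] + 2 * (g + 1) = card E + 1" using V G cE by simp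
      then show ?thesis by blast
    next
      case False
      obtain G where G: "G \<subseteq> F" "covers G [a]" "covers (F - G) [b]"
        using covers_unlinked[of F "[a]" "[b]"] c False by auto
      have fin: "finite G" "finite (F - G)" using G finF finite_subset by auto
      have card: "card F = card G + card (F - G)"
        using G finF by (metis card_Diff_subset card_mono fin(1) le_add_diff_inverse)
      obtain g where g: "vertices G [a] + 2 * g = card G + 1"
        using less.hyps[of G a] G fin cE card by auto
      obtain h where h: "vertices (F - G) [b] + 2 * h = card (F - G) + 1"
        using less.hyps[of "F - G" b] G fin cE card by auto
      have "vertices F [a, b] = vertices G [a] + vertices (F - G) [b]"
        using vertices_append[OF G(2,3) _ fin] G(1) by (simp add: Un_absorb1)
      then have "vertices E [f] + 2 * (g + h) = card E + 1" using V cE card g h by simp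
      then show ?thesis by blast
    qed
  qed
qed

lemma genus_pair:
  assumes "finite E" "covers E [f, f']" "adjacent f f'"
  shows "\<exists>g. vertices E [f, f'] + 2 * g = card E"
proof -
  obtain G h where G: "finite G" "card E = card G + 1" "covers G [h]"
    "vertices E [f, f'] = vertices G [h]"
    using covers_pair_linkedE[OF assms(2,3,1)] .
  then show ?thesis using genus_single[OF G(1,3)] by simp
qed

section \<open>Deleting the root edge\<close>

text \<open>The equation is Euler's V - E + K = 2 - 2g, rearranged to avoid subtraction of natural
  numbers.\<close>

definition rooted_maps :: "nat set \<Rightarrow> nat \<Rightarrow> nat \<Rightarrow> dart list list set" where
  "rooted_maps E K g = {fs. length fs = K \<and> covers E fs \<and> linked E fs \<and>
    vertices E fs + K + 2 * g = card E + 2}"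

lemma finite_maps:
  assumes "finite E"
  shows "finite (rooted_maps E K g)"
proof (rule finite_subset)
  let ?L = "{l :: dart list. set l \<subseteq> E \<times> UNIV \<and> distinct l}"
  have "distinct f" if "distinct (concat fs)" "f \<in> set fs" for f and fs :: "dart list list"
    using that by (induction fs) auto
  then show "rooted_maps E K g \<subseteq> {fs. set fs \<subseteq> ?L \<and> length fs = K}"
    unfolding rooted_maps_def covers_def by fastforce
  show "finite {fs. set fs \<subseteq> ?L \<and> length fs = K}"
    using assms by (intro finite_lists_length_eq finite_subset_distinct) simp
qed

lemma maps_disjoint: "g \<noteq> h \<Longrightarrow> rooted_maps E K g \<inter> rooted_maps E K h = {}"
  unfolding rooted_maps_def by auto

section \<open>The root edge joins the two faces\<close>

lemma card_cut_triples: "card {(a, b, c). a @ b @ c = f} = (length f + 1) * (length f + 2) div 2"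
proof -
  let ?I = "SIGMA j:{..length f}. {..j}"
  let ?h = "\<lambda>(j, i). (take i f, drop i (take j f), drop j f)"
  have eq: "{(a, b, c). a @ b @ c = f} = ?h ` ?I"
  proof (intro equalityI subsetI)
    fix x assume "x \<in> {(a, b, c). a @ b @ c = f}"
    then obtain a b c where x: "x = (a, b, c)" "f = a @ b @ c" by auto
    then have "x = ?h (length a + length b, length a)" by simp
    moreover have "(length a + length b, length a) \<in> ?I" using x by simp
    ultimately show "x \<in> ?h ` ?I" by (rule image_eqI)
  next
    fix x assume "x \<in> ?h ` ?I"
    then obtain i j where x: "x = (take i f, drop i (take j f), drop j f)" "i \<le> j" by auto
    have "take i f @ drop i (take j f) = take j f"
      using append_take_drop_id[of i "take j f"] x(2) by (simp add: min_absorb1)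
    then show "x \<in> {(a, b, c). a @ b @ c = f}"
      using x append_take_drop_id[of j f] by (simp flip: append_assoc)
  qed
  have "inj_on ?h ?I"
  proof (rule inj_onI, clarify)
    fix j i j' i'
    assume le: "j \<le> length f" "i \<le> j" "j' \<le> length f" "i' \<le> j'"
      and e: "take i f = take i' f" "drop j f = drop j' f"
    have "length (take i f) = length (take i' f)" "length (drop j f) = length (drop j' f)"
      using e by simp_all
    then show "j = j' \<and> i = i'" using le by (simp add: min_absorb2)
  qed
  then have "card {(a, b, c). a @ b @ c = f} = card ?I"
    unfolding eq by (rule card_image)
  also have "\<dots> = (\<Sum>j\<le>length f. j + 1)"
    by (subst card_SigmaI) auto
  also have "\<dots> = (length f + 1) * (length f + 2) div 2"
  proof -
    have "2 * (\<Sum>j\<le>n. j + 1) = (n + 1) * (n + 2)" for n :: nat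
      by (induction n) (simp_all add: algebra_simps)
    from this[of "length f"] show ?thesis by simp
  qed
  finally show ?thesis .
qed

lemma covers_length:
  assumes "covers E fs" "finite E"
  shows "length (concat fs) = 2 * card E"
proof -
  have "length (concat fs) = card (set (concat fs))"
    using assms(1) unfolding covers_def by (metis distinct_card)
  also have "\<dots> = 2 * card E"
    using assms by (simp add: covers_def card_cartesian_product)
  finally show ?thesis .
qed

text \<open>One edge and one face disappear and the vertices stay, so the genus does not change.
  Connectivity is automatic on both sides, since the edge of \<open>r\<close> joins the two
  faces.\<close>

lemma maps_merge_iff:
  assumes "fst r \<notin> E" "finite E"
  shows "[r # a, c @ opp r # d] \<in> rooted_maps (insert (fst r) E) 2 1 \<longleftrightarrow> [a @ d @ c] \<in> rooted_maps E 1 1"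
proof (cases "covers E [a @ d @ c]")
  case True
  then have c: "covers (insert (fst r) E) [r # a, c @ opp r # d]"
    using covers_merge[OF assms(1), of a c d "[]"] by simp
  have "linked (insert (fst r) E) [r # a, c @ opp r # d]"
    unfolding linked_pair[OF c] by (simp add: adjacent_def)
  then show ?thesis
    using True c linked_single[OF True] vertices_merge[OF assms c] assms
    by (simp add: rooted_maps_def)
next
  case False
  then show ?thesis
    using covers_merge[OF assms(1), of a c d "[]"] by (simp add: rooted_maps_def)
qed

text \<open>The merged word forgets only its two cuts. Conversely, \<open>opp r\<close> does not
  occur in the merged word, so its position in the second face determines \<open>c\<close> and
  \<open>d\<close>.\<close>

lemma card_merge:
  assumes "fst r \<notin> E" "finite E" "n = card E + 1"
  shows "card {fs \<in> rooted_maps (insert (fst r) E) 2 1. \<exists>a f. fs = [r # a, f] \<and> opp r \<in> set f}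
    = n * (2 * n - 1) * card (rooted_maps E 1 1)" (is "card ?M = _")
proof -
  let ?I = "SIGMA fs:rooted_maps E 1 1. {(a, d, c). a @ d @ c = hd fs}"
  let ?h = "\<lambda>(fs :: dart list list, a, d, c). [r # a, c @ opp r # d]"
  have eq: "?M = ?h ` ?I"
  proof (intro equalityI subsetI)
    fix fs assume "fs \<in> ?M"
    then obtain a f where fs: "fs \<in> rooted_maps (insert (fst r) E) 2 1" "fs = [r # a, f]" "opp r \<in> set f"
      by auto
    then obtain c d where f: "f = c @ opp r # d" using split_list by metis
    then have "[a @ d @ c] \<in> rooted_maps E 1 1" using fs maps_merge_iff[OF assms(1,2)] by simp
    then have "([a @ d @ c], a, d, c) \<in> ?I" by simp
    moreover have "fs = ?h ([a @ d @ c], a, d, c)" using fs f by simp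
    ultimately show "fs \<in> ?h ` ?I" by (rule rev_image_eqI)
  next
    fix fs assume "fs \<in> ?h ` ?I"
    then obtain gs a d c where gs: "gs \<in> rooted_maps E 1 1" "a @ d @ c = hd gs" "fs = [r # a, c @ opp r # d]"
      by auto
    then have "gs = [a @ d @ c]" by (cases gs) (auto simp: rooted_maps_def)
    then show "fs \<in> ?M" using gs maps_merge_iff[OF assms(1,2)] by simp
  qed
  have inj: "inj_on ?h ?I"
  proof (rule inj_onI)
    fix x y assume x: "x \<in> ?I" and y: "y \<in> ?I" and h: "?h x = ?h y"
    obtain fs a d c where x': "x = (fs, a, d, c)" by (cases x)
    obtain fs' a' d' c' where y': "y = (fs', a', d', c')" by (cases y)
    have m: "fs \<in> rooted_maps E 1 1" "fs' \<in> rooted_maps E 1 1"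
      and f: "a @ d @ c = hd fs" "a' @ d' @ c' = hd fs'"
      and e: "[r # a, c @ opp r # d] = [r # a', c' @ opp r # d']"
      using x y h by (simp_all add: x' y')
    have l: "fs = [hd fs]" "fs' = [hd fs']" using m by (auto simp: rooted_maps_def length_Suc_conv)
    have "opp r \<notin> set (concat fs)" "opp r \<notin> set (concat fs')"
      using m dart_notin_Times(2)[OF assms(1)] by (simp_all add: rooted_maps_def covers_def)
    moreover have "concat fs = a @ d @ c" "concat fs' = a' @ d' @ c'"
      using l f by (metis concat.simps append_Nil2)+
    ultimately have "opp r \<notin> set c" "opp r \<notin> set c'" "opp r \<notin> set d" "opp r \<notin> set d'" by auto
    moreover have "c @ opp r # d = c' @ opp r # d'" "a = a'" using e by simp_all
    ultimately have "c = c' \<and> d = d' \<and> a = a'"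
      by (metis append_Cons_eq_iff)
    then show "x = y" unfolding x' y' using l f by metis
  qed
  have "card ?M = card ?I" unfolding eq by (rule card_image[OF inj])
  also have "\<dots> = (\<Sum>fs\<in>rooted_maps E 1 1. n * (2 * n - 1))"
  proof (subst card_SigmaI)
    show "finite (rooted_maps E 1 1)" by (rule finite_maps[OF assms(2)])
    have card: "card {(a, d, c). a @ d @ c = hd fs} = n * (2 * n - 1)" if "fs \<in> rooted_maps E 1 1" for fs
    proof -
      have "covers E fs" "fs = [hd fs]" using that by (auto simp: rooted_maps_def length_Suc_conv)
      then have "length (hd fs) = 2 * card E"
        using covers_length[of E fs] assms(2) by (metis concat.simps append_Nil2)
      \<comment> \<open>A word of length \<open>2 * n - 2\<close> has \<open>2 * n - 1\<close>
        places to cut, and two cuts may coincide: this gives \<open>n * (2 * n - 1)\<close>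
        choices.\<close>
      then have "card {(a, d, c). a @ d @ c = hd fs} = (2 * card E + 1) * (2 * card E + 2) div 2"
        using card_cut_triples[of "hd fs"] by simp
      also have "(2 * card E + 1) * (2 * card E + 2) = 2 * (n * (2 * n - 1))"
        using assms(3) by (simp add: algebra_simps)
      finally show ?thesis by simp
    qed
    \<comment> \<open>Infinite sets have \<open>card\<close> 0, so a nonzero count yields
      finiteness.\<close>
    have "n * (2 * n - 1) \<noteq> 0" using assms(3) by simp
    then show "\<forall>fs\<in>rooted_maps E 1 1. finite {(a, d, c). a @ d @ c = hd fs}"
      using card by (metis card.infinite)
    show "(\<Sum>fs\<in>rooted_maps E 1 1. card {(a, d, c). a @ d @ c = hd fs}) = (\<Sum>fs\<in>rooted_maps E 1 1. n * (2 * n - 1))"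
      using card by (rule sum.cong[OF refl])
  qed
  finally show ?thesis by simp
qed

section \<open>The root edge has the first face on both sides\<close>

definition split_faces :: "nat set \<Rightarrow> dart list list set" where
  "split_faces E = {fs. \<exists>a b f. fs = [a, b, f] \<and> covers E fs \<and> (adjacent a f \<or> adjacent b f) \<and>
    vertices E fs + 1 = card E}"

text \<open>Both darts of the root edge lie in the first face, so the connection to \<open>f\<close>
  must come from \<open>a\<close> or \<open>b\<close>, while \<open>a\<close> and \<open>b\<close>
  may or may not share an edge. Euler's relation for genus 1, two faces and one more edge becomes
  \<open>vertices E fs + 1 = card E\<close>, which for a connected triple means genus 0.\<close>

lemma maps_split_iff:
  assumes "fst r \<notin> E" "finite E"
  shows "[r # a @ opp r # b, f] \<in> rooted_maps (insert (fst r) E) 2 1 \<longleftrightarrow> [a, b, f] \<in> split_faces E"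
proof (cases "covers E [a, b, f]")
  case True
  then have c: "covers (insert (fst r) E) [r # a @ opp r # b, f]"
    using covers_split[OF assms(1), of a b "[f]"] by simp
  then have "r \<notin> set f" "opp r \<notin> set f" by (auto simp: covers_def)
  then have "linked (insert (fst r) E) [r # a @ opp r # b, f] \<longleftrightarrow> adjacent a f \<or> adjacent b f"
    unfolding linked_pair[OF c] by (auto simp: adjacent_def)
  then show ?thesis
    using True c vertices_split[OF assms c] assms
    by (auto simp: rooted_maps_def split_faces_def)
next
  case False
  then show ?thesis
    using covers_split[OF assms(1), of a b "[f]"] by (simp add: rooted_maps_def split_faces_def)
qed

lemma card_split:
  assumes "fst r \<notin> E" "finite E"
  shows "card {fs \<in> rooted_maps (insert (fst r) E) 2 1. \<exists>a f. fs = [r # a, f] \<and> opp r \<in> set a}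
    = card (split_faces E)" (is "card ?M = _")
proof -
  let ?h = "\<lambda>fs. [r # fs ! 0 @ opp r # fs ! 1, fs ! 2]"
  have eq: "?M = ?h ` split_faces E"
  proof (intro equalityI subsetI)
    fix fs assume "fs \<in> ?M"
    then obtain w f where fs: "fs \<in> rooted_maps (insert (fst r) E) 2 1" "fs = [r # w, f]" "opp r \<in> set w"
      by auto
    then obtain a b where w: "w = a @ opp r # b" using split_list by metis
    then have "[a, b, f] \<in> split_faces E" using fs maps_split_iff[OF assms] by simp
    moreover have "fs = ?h [a, b, f]" using fs w by simp
    ultimately show "fs \<in> ?h ` split_faces E" by (rule rev_image_eqI)
  next
    fix fs assume "fs \<in> ?h ` split_faces E"
    then obtain gs where gs: "gs \<in> split_faces E" "fs = ?h gs" by blast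
    then obtain a b f where abf: "gs = [a, b, f]" by (auto simp: split_faces_def)
    then have "fs = [r # a @ opp r # b, f]" using gs by simp
    then show "fs \<in> ?M" using gs(1) abf maps_split_iff[OF assms, of a b f] by simp
  qed
  have inj: "inj_on ?h (split_faces E)"
  proof (rule inj_onI)
    fix fs fs' assume m: "fs \<in> split_faces E" "fs' \<in> split_faces E" and e: "?h fs = ?h fs'"
    obtain a b f where fs: "fs = [a, b, f]" using m by (auto simp: split_faces_def)
    obtain a' b' f' where fs': "fs' = [a', b', f']" using m by (auto simp: split_faces_def)
    have "opp r \<notin> set (concat fs)" "opp r \<notin> set (concat fs')"
      using m dart_notin_Times(2)[OF assms(1)] by (auto simp: split_faces_def covers_def)
    then have "opp r \<notin> set a" "opp r \<notin> set a'" "opp r \<notin> set b" "opp r \<notin> set b'"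
      by (simp_all add: fs fs')
    moreover have "a @ opp r # b = a' @ opp r # b'" "f = f'" using e by (simp_all add: fs fs')
    ultimately show "fs = fs'"
      unfolding fs fs' by (metis append_Cons_eq_iff)
  qed
  show ?thesis unfolding eq by (rule card_image[OF inj])
qed

text \<open>Only the case in which the first half \<open>a\<close> is alone; the case of
  \<open>b\<close> is its mirror image under exchange of the first two faces.\<close>

definition components :: "nat set \<Rightarrow> dart list list set" where
  "components E = (\<lambda>(F, fs, gs). fs @ gs) ` (SIGMA F:Pow E.
    rooted_maps F 1 0 \<times> rooted_maps (E - F) 2 1 \<union> rooted_maps F 1 1 \<times> rooted_maps (E - F) 2 0)"

lemma card_components:
  assumes "finite E"
  shows "card (components E) = (\<Sum>F\<in>Pow E.
    card (rooted_maps F 1 0) * card (rooted_maps (E - F) 2 1) + card (rooted_maps F 1 1) * card (rooted_maps (E - F) 2 0))"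
proof -
  let ?S = "\<lambda>F. rooted_maps F 1 0 \<times> rooted_maps (E - F) 2 1 \<union> rooted_maps F 1 1 \<times> rooted_maps (E - F) 2 0"
  let ?h = "\<lambda>(F :: nat set, fs :: dart list list, gs). fs @ gs"
  have "inj_on ?h (Sigma (Pow E) ?S)"
  proof (rule inj_onI)
    fix x y assume x: "x \<in> Sigma (Pow E) ?S" and y: "y \<in> Sigma (Pow E) ?S" and h: "?h x = ?h y"
    obtain F fs gs where x': "x = (F, fs, gs)" by (cases x)
    obtain F' fs' gs' where y': "y = (F', fs', gs')" by (cases y)
    have m: "(fs, gs) \<in> ?S F" "(fs', gs') \<in> ?S F'" and e: "fs @ gs = fs' @ gs'"
      using x y h by (simp_all add: x' y')
    have "length fs = 1" "length fs' = 1" using m by (auto simp: rooted_maps_def)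
    then have "fs = fs'" "gs = gs'" using e by simp_all
    moreover have "set (concat fs) = F \<times> UNIV" "set (concat fs') = F' \<times> UNIV"
      using m by (auto simp: rooted_maps_def covers_def)
    ultimately have "F \<times> (UNIV :: bool set) = F' \<times> UNIV" by simp
    then have "F = F'" by (auto simp: times_eq_iff)
    then show "x = y" using \<open>fs = fs'\<close> \<open>gs = gs'\<close> by (simp add: x' y')
  qed
  then have "card (components E) = card (Sigma (Pow E) ?S)"
    unfolding components_def by (rule card_image)
  also have "\<dots> = (\<Sum>F\<in>Pow E. card (?S F))"
    using assms by (subst card_SigmaI) (auto intro!: finite_maps elim: finite_subset)
  also have "\<dots> = (\<Sum>F\<in>Pow E.
    card (rooted_maps F 1 0) * card (rooted_maps (E - F) 2 1) + card (rooted_maps F 1 1) * card (rooted_maps (E - F) 2 0))"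
  proof (rule sum.cong[OF refl])
    fix F assume "F \<in> Pow E"
    then have fin: "finite F" "finite (E - F)" using assms finite_subset by auto
    have "card (?S F) = card (rooted_maps F 1 0 \<times> rooted_maps (E - F) 2 1) + card (rooted_maps F 1 1 \<times> rooted_maps (E - F) 2 0)"
      using maps_disjoint[of 0 1 F 1] finite_maps[OF fin(1)] finite_maps[OF fin(2)]
      by (intro card_Un_disjoint) auto
    then show "card (?S F) = card (rooted_maps F 1 0) * card (rooted_maps (E - F) 2 1)
        + card (rooted_maps F 1 1) * card (rooted_maps (E - F) 2 0)"
      by (simp add: card_cartesian_product)
  qed
  finally show ?thesis .
qed

text \<open>Euler characteristics add up, so exactly one of the two components carries the handle.\<close>
lemma mem_components_iff:
  assumes "finite E"
  shows "[a, b, f] \<in> components E \<longleftrightarrow>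
    [a, b, f] \<in> split_faces E \<and> \<not> adjacent a b \<and> \<not> adjacent a f"
proof
  assume "[a, b, f] \<in> components E"
  then obtain F fs gs where F: "F \<subseteq> E" "[a, b, f] = fs @ gs"
    and m: "fs \<in> rooted_maps F 1 0 \<and> gs \<in> rooted_maps (E - F) 2 1 \<or> fs \<in> rooted_maps F 1 1 \<and> gs \<in> rooted_maps (E - F) 2 0"
    unfolding components_def by auto
  have "length fs = 1" using m by (auto simp: rooted_maps_def)
  then have fg: "fs = [a]" "gs = [b, f]" using F(2) by (cases fs; simp)+
  have c: "covers F [a]" "covers (E - F) [b, f]" and l: "linked (E - F) [b, f]"
    using m by (auto simp: rooted_maps_def fg)
  have fin: "finite F" "finite (E - F)" using assms F finite_subset by auto
  have card: "card E = card F + card (E - F)"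
    using F fin by (metis card_Diff_subset card_mono assms le_add_diff_inverse)
  have "covers E [a, b, f]"
    using covers_append[OF c] F(1) by (simp add: Un_absorb1)
  moreover have "vertices E [a, b, f] = vertices F [a] + vertices (E - F) [b, f]"
    using vertices_append[OF c _ fin] F(1) by (simp add: Un_absorb1)
  then have "vertices E [a, b, f] + 1 = card E"
    using m card by (auto simp: rooted_maps_def fg)
  moreover have "adjacent b f" using l linked_pair[OF c(2)] by simp
  ultimately have "[a, b, f] \<in> split_faces E" by (simp add: split_faces_def)
  moreover have "\<not> adjacent a g" if "g \<in> {b, f}" for g
  proof
    assume "adjacent a g"
    then obtain x where x: "x \<in> set a" "opp x \<in> set g" unfolding adjacent_def by auto
    have "set a = F \<times> UNIV" "set b \<union> set f = (E - F) \<times> UNIV" using c by (auto simp: covers_def)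
    then have "x \<in> F \<times> UNIV" "opp x \<in> (E - F) \<times> UNIV" using x that by auto
    then have "fst x \<in> F" "fst x \<notin> F" by (simp_all add: mem_Times_iff)
    then show False by simp
  qed
  ultimately show "[a, b, f] \<in> split_faces E \<and> \<not> adjacent a b \<and> \<not> adjacent a f" by simp
next
  assume a: "[a, b, f] \<in> split_faces E \<and> \<not> adjacent a b \<and> \<not> adjacent a f"
  then have c: "covers E ([a] @ [b, f])" and ad: "adjacent b f" and V: "vertices E [a, b, f] + 1 = card E"
    by (auto simp: split_faces_def)
  obtain F where F: "F \<subseteq> E" "covers F [a]" "covers (E - F) [b, f]"
    using covers_unlinked[OF c] a by auto
  have fin: "finite F" "finite (E - F)" using assms F finite_subset by auto
  have card: "card E = card F + card (E - F)"
    using F fin by (metis card_Diff_subset card_mono assms le_add_diff_inverse)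
  have "vertices E [a, b, f] = vertices F [a] + vertices (E - F) [b, f]"
    using vertices_append[OF F(2,3) _ fin] F(1) by (simp add: Un_absorb1)
  moreover obtain g where g: "vertices F [a] + 2 * g = card F + 1"
    using genus_single[OF fin(1) F(2)] by blast
  moreover obtain h where h: "vertices (E - F) [b, f] + 2 * h = card (E - F)"
    using genus_pair[OF fin(2) F(3) ad] by blast
  \<comment> \<open>The two Euler relations add up to
    \<open>vertices E [a, b, f] + 2 * (g + h) = card E + 1\<close>, whereas the number of vertices
    is \<open>card E - 1\<close>.\<close>
  ultimately have "g + h = 1" using V card by simp
  then have "g = 0 \<and> h = 1 \<or> g = 1 \<and> h = 0" by auto
  then have "([a], [b, f]) \<in> rooted_maps F 1 0 \<times> rooted_maps (E - F) 2 1 \<union> rooted_maps F 1 1 \<times> rooted_maps (E - F) 2 0"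
    using g h F linked_single[OF F(2)] ad linked_pair[OF F(3)] by (auto simp: rooted_maps_def)
  then have "(F, [a], [b, f]) \<in> (SIGMA F:Pow E.
      rooted_maps F 1 0 \<times> rooted_maps (E - F) 2 1 \<union> rooted_maps F 1 1 \<times> rooted_maps (E - F) 2 0)"
    using F(1) by simp
  then show "[a, b, f] \<in> components E"
    unfolding components_def by (rule rev_image_eqI) simp
qed

lemma split_faces_swap: "[a, b, f] \<in> split_faces E \<longleftrightarrow> [b, a, f] \<in> split_faces E"
proof -
  have "covers E [a, b, f] \<longleftrightarrow> covers E [b, a, f]" by (rule covers_swap)
  moreover have "vertices E [a, b, f] = vertices E [b, a, f]" if "covers E [a, b, f]"
    using vertices_swap[OF that] .
  ultimately show ?thesis by (auto simp: split_faces_def)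
qed

text \<open>At least one of the pairs \<open>a\<close>, \<open>f\<close> and \<open>b\<close>,
  \<open>f\<close> is adjacent. If at least two of the three pairs are adjacent, the triple is
  connected; if only \<open>b\<close>, \<open>f\<close> is, then \<open>a\<close> is alone; if only
  \<open>a\<close>, \<open>f\<close> is, then \<open>b\<close> is alone. The last two cases
  correspond under exchange of \<open>a\<close> and \<open>b\<close>, whence the factor 2.\<close>

lemma card_split_faces:
  assumes "finite E"
  shows "card (split_faces E) = card (rooted_maps E 3 0) + 2 * (\<Sum>F\<in>Pow E.
    card (rooted_maps F 1 0) * card (rooted_maps (E - F) 2 1) + card (rooted_maps F 1 1) * card (rooted_maps (E - F) 2 0))"
proof -
  let ?sw = "\<lambda>fs :: dart list list. [fs ! 1, fs ! 0, fs ! 2]"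
  have len: "\<exists>a b f. fs = [a, b, f]" if "fs \<in> split_faces E \<or> fs \<in> rooted_maps E 3 0 \<or> fs \<in> components E" for fs
    using that unfolding components_def
    by (auto simp: split_faces_def rooted_maps_def length_Suc_conv numeral_2_eq_2 numeral_3_eq_3)
  have sw: "[a, b, f] \<in> ?sw ` components E \<longleftrightarrow> [b, a, f] \<in> components E" for a b f
  proof
    assume "[a, b, f] \<in> ?sw ` components E"
    then obtain fs where "fs \<in> components E" "[a, b, f] = ?sw fs" by blast
    then show "[b, a, f] \<in> components E" using len[of fs] by auto
  qed (rule rev_image_eqI, auto)
  have maps3: "[a, b, f] \<in> rooted_maps E 3 0 \<longleftrightarrow> [a, b, f] \<in> split_faces E \<and>
    (adjacent a b \<and> adjacent b f \<or> adjacent b f \<and> adjacent a f \<or> adjacent a f \<and> adjacent a b)" for a b f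
    using linked_triple[of E a b f] by (auto simp: rooted_maps_def split_faces_def)
  have comp: "[b, a, f] \<in> components E \<longleftrightarrow>
    [a, b, f] \<in> split_faces E \<and> \<not> adjacent a b \<and> \<not> adjacent b f" for a b f
    using mem_components_iff[OF assms, of b a f] split_faces_swap[of a b f E] adjacent_sym[of a b] by simp
  have adj: "adjacent a f \<or> adjacent b f" if "[a, b, f] \<in> split_faces E" for a b f
    using that by (auto simp: split_faces_def)
  have sw': "[a, b, f] \<in> ?sw ` components E \<longleftrightarrow>
    [a, b, f] \<in> split_faces E \<and> \<not> adjacent a b \<and> \<not> adjacent b f" for a b f
    unfolding sw comp ..
  note mem = sw' maps3 mem_components_iff[OF assms]
  have lsw: "\<exists>a b f. fs = [a, b, f]" if "fs \<in> ?sw ` components E" for fs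
    using that by blast
  have "split_faces E = rooted_maps E 3 0 \<union> (components E \<union> ?sw ` components E)" (is "?l = ?r")
  proof (intro equalityI subsetI)
    fix fs assume "fs \<in> ?l"
    then obtain a b f where abf: "fs = [a, b, f]" using len[of fs] by blast
    then show "fs \<in> ?r" using \<open>fs \<in> ?l\<close> mem adj[of a b f] by auto
  next
    fix fs assume fs: "fs \<in> ?r"
    then obtain a b f where "fs = [a, b, f]" using len[of fs] lsw[of fs] by blast
    then show "fs \<in> ?l" using fs mem by auto
  qed
  moreover have "rooted_maps E 3 0 \<inter> (components E \<union> ?sw ` components E) = {}"
  proof (intro equals0I)
    fix fs assume fs: "fs \<in> rooted_maps E 3 0 \<inter> (components E \<union> ?sw ` components E)"
    then obtain a b f where "fs = [a, b, f]" using len[of fs] by blast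
    then show False using fs mem by auto
  qed
  moreover have "components E \<inter> ?sw ` components E = {}"
  proof (intro equals0I)
    fix fs assume fs: "fs \<in> components E \<inter> ?sw ` components E"
    then obtain a b f where "fs = [a, b, f]" using len[of fs] by blast
    then show False using fs mem adj[of a b f] by auto
  qed
  moreover have fin: "finite (components E)"
    unfolding components_def
    by (intro finite_imageI finite_SigmaI finite_UnI finite_cartesian_product finite_maps)
      (use assms finite_subset in auto)
  moreover have "card (?sw ` components E) = card (components E)"
  proof (rule card_image, rule inj_onI)
    fix fs fs' assume "fs \<in> components E" "fs' \<in> components E" "?sw fs = ?sw fs'"
    then show "fs = fs'" using len[of fs] len[of fs'] by auto
  qed
  ultimately have "card (split_faces E) = card (rooted_maps E 3 0) + 2 * card (components E)"
    using finite_maps[OF assms] by (simp add: card_Un_disjoint)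
  then show ?thesis by (simp only: card_components[OF assms])
qed

section \<open>Summation over the root dart\<close>

lemma card_maps_rooted:
  assumes "fst r \<notin> E" "finite E" "n = card E + 1"
  shows "card {fs \<in> rooted_maps (insert (fst r) E) 2 1. \<exists>a f. fs = [r # a, f]}
    = n * (2 * n - 1) * card (rooted_maps E 1 1) + card (rooted_maps E 3 0) + 2 * (\<Sum>F\<in>Pow E.
      card (rooted_maps F 1 0) * card (rooted_maps (E - F) 2 1) + card (rooted_maps F 1 1) * card (rooted_maps (E - F) 2 0))"
    (is "card ?A = _")
proof -
  let ?M = "{fs \<in> rooted_maps (insert (fst r) E) 2 1. \<exists>a f. fs = [r # a, f] \<and> opp r \<in> set f}"
  let ?S = "{fs \<in> rooted_maps (insert (fst r) E) 2 1. \<exists>a f. fs = [r # a, f] \<and> opp r \<in> set a}"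
  have opp_in: "opp r \<in> set a \<or> opp r \<in> set f" "\<not> (opp r \<in> set a \<and> opp r \<in> set f)"
    if "[r # a, f] \<in> rooted_maps (insert (fst r) E) 2 1" for a f
  proof -
    have c: "covers (insert (fst r) E) [r # a, f]" using that by (simp add: rooted_maps_def)
    then have "opp r \<in> set (concat [r # a, f])"
      unfolding covers_def by (simp add: mem_Times_iff)
    then show "opp r \<in> set a \<or> opp r \<in> set f" by simp
    show "\<not> (opp r \<in> set a \<and> opp r \<in> set f)" using c by (auto simp: covers_def)
  qed
  then have "?A = ?M \<union> ?S" by blast
  moreover have "?M \<inter> ?S = {}" using opp_in(2) by blast
  moreover have "finite (rooted_maps (insert (fst r) E) 2 1)" using assms finite_maps by simp
  ultimately have "card ?A = card ?M + card ?S"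
    by (simp add: card_Un_disjoint)
  then show ?thesis
    using card_merge[OF assms] card_split[OF assms(1,2)] card_split_faces[OF assms(2)] by simp
qed

text \<open>A linked pair has no empty face, so each list has exactly one root dart, the first
  letter of its first face; the lists are sorted by it.\<close>

lemma card_maps_pair:
  assumes "finite E" "n = card E"
  shows "card (rooted_maps E 2 1) = (\<Sum>r \<in> E \<times> (UNIV :: bool set).
    n * (2 * n - 1) * card (rooted_maps (E - {fst r}) 1 1) + card (rooted_maps (E - {fst r}) 3 0)
    + 2 * (\<Sum>F\<in>Pow (E - {fst r}). card (rooted_maps F 1 0) * card (rooted_maps (E - {fst r} - F) 2 1)
      + card (rooted_maps F 1 1) * card (rooted_maps (E - {fst r} - F) 2 0)))"
proof -
  let ?A = "\<lambda>r. {fs \<in> rooted_maps E 2 1. \<exists>a f. fs = [r # a, f]}"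
  have "rooted_maps E 2 1 = (\<Union>r \<in> E \<times> UNIV. ?A r)"
  proof (intro equalityI subsetI)
    fix fs assume fs: "fs \<in> rooted_maps E 2 1"
    then obtain f g where fg: "fs = [f, g]"
      by (auto simp: rooted_maps_def length_Suc_conv numeral_2_eq_2)
    have "f \<noteq> []" using fs by (auto simp: fg rooted_maps_def linked_def)
    then obtain r a where f: "f = r # a" by (cases f) auto
    have "r \<in> E \<times> UNIV" using fs by (auto simp: fg f rooted_maps_def covers_def)
    then show "fs \<in> (\<Union>r \<in> E \<times> UNIV. ?A r)" using fs fg f by blast
  qed auto
  also have "card \<dots> = (\<Sum>r \<in> E \<times> UNIV. card (?A r))"
    using assms(1) finite_maps[OF assms(1)] by (intro card_UN_disjoint) auto
  also have "\<dots> = (\<Sum>r \<in> E \<times> (UNIV :: bool set).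
    n * (2 * n - 1) * card (rooted_maps (E - {fst r}) 1 1) + card (rooted_maps (E - {fst r}) 3 0)
    + 2 * (\<Sum>F\<in>Pow (E - {fst r}). card (rooted_maps F 1 0) * card (rooted_maps (E - {fst r} - F) 2 1)
      + card (rooted_maps F 1 1) * card (rooted_maps (E - {fst r} - F) 2 0)))"
  proof (rule sum.cong[OF refl])
    fix r assume "r \<in> E \<times> (UNIV :: bool set)"
    then have r: "fst r \<in> E" by auto
    then have "insert (fst r) (E - {fst r}) = E" by auto
    moreover have "n = card (E - {fst r}) + 1"
      using assms r by (metis card_Suc_Diff1 Suc_eq_plus1)
    ultimately show "card (?A r) = n * (2 * n - 1) * card (rooted_maps (E - {fst r}) 1 1)
      + card (rooted_maps (E - {fst r}) 3 0)
      + 2 * (\<Sum>F\<in>Pow (E - {fst r}). card (rooted_maps F 1 0) * card (rooted_maps (E - {fst r} - F) 2 1)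
        + card (rooted_maps F 1 1) * card (rooted_maps (E - {fst r} - F) 2 0))"
      using card_maps_rooted[of r "E - {fst r}" n] assms(1) by simp
  qed
  finally show ?thesis .
qed

section \<open>Gluing data and labelled maps\<close>

text \<open>The image of one point \<open>x\<close> is free and forces that of its partner. With
  \<open>Suc n\<close> pairs this leaves \<open>2 * Suc n\<close> choices, times the bijections
  between the remaining \<open>n\<close> pairs.\<close>

lemma card_equivariant_bijections:
  assumes "finite X" "\<And>x. x \<in> X \<Longrightarrow> \<alpha> x \<in> X \<and> \<alpha> (\<alpha> x) = x \<and> \<alpha> x \<noteq> x" "card X = 2 * n"
    and "finite Y" "\<And>y. y \<in> Y \<Longrightarrow> \<beta> y \<in> Y \<and> \<beta> (\<beta> y) = y \<and> \<beta> y \<noteq> y" "card Y = 2 * n"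
  shows "card {f \<in> X \<rightarrow>\<^sub>E Y. bij_betw f X Y \<and> (\<forall>x\<in>X. f (\<alpha> x) = \<beta> (f x))} = 2 ^ n * fact n"
  using assms
proof (induction n arbitrary: X Y)
  case 0
  then have "X = {}" "Y = {}" by auto
  then have "{f \<in> X \<rightarrow>\<^sub>E Y. bij_betw f X Y \<and> (\<forall>x\<in>X. f (\<alpha> x) = \<beta> (f x))} = {\<lambda>_. undefined}"
    by (auto simp: bij_betw_def)
  then show ?case by simp
next
  case (Suc n)
  define B where "B = (\<lambda>X Y. {f \<in> X \<rightarrow>\<^sub>E Y. bij_betw f X Y \<and> (\<forall>x\<in>X. f (\<alpha> x) = \<beta> (f x))})"
  have \<alpha>: "\<alpha> x \<in> X" "\<alpha> (\<alpha> x) = x" "\<alpha> x \<noteq> x" if "x \<in> X" for x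
    using Suc.prems(2) that by auto
  have \<beta>: "\<beta> x \<in> Y" "\<beta> (\<beta> x) = x" "\<beta> x \<noteq> x" if "x \<in> Y" for x
    using Suc.prems(5) that by auto
  have "X \<noteq> {}" using Suc.prems(3) by auto
  then obtain x where x: "x \<in> X" by auto
  define X' where "X' = X - {x, \<alpha> x}"
  have X: "X = insert x (insert (\<alpha> x) X')" "x \<notin> X'" "\<alpha> x \<notin> X'"
    using x \<alpha>(1) by (auto simp: X'_def)
  have part: "card {f \<in> B X Y. f x = y} = 2 ^ n * fact n" if y: "y \<in> Y" for y
  proof -
    define Y' where "Y' = Y - {y, \<beta> y}"
    have Y: "Y = insert y (insert (\<beta> y) Y')" "y \<notin> Y'" "\<beta> y \<notin> Y'"
      using y \<beta>(1) by (auto simp: Y'_def)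
    have \<alpha>': "\<alpha> z \<in> X'" if "z \<in> X'" for z
    proof -
      have "z \<in> X" "z \<noteq> x" "z \<noteq> \<alpha> x" using that by (auto simp: X'_def)
      then have "\<alpha> z \<noteq> x" "\<alpha> z \<noteq> \<alpha> x" using \<alpha>(2)[of z] \<alpha>(2)[OF x] by auto
      then show ?thesis using \<alpha>(1)[OF \<open>z \<in> X\<close>] by (simp add: X'_def)
    qed
    have \<beta>': "\<beta> z \<in> Y'" if "z \<in> Y'" for z
    proof -
      have "z \<in> Y" "z \<noteq> y" "z \<noteq> \<beta> y" using that by (auto simp: Y'_def)
      then have "\<beta> z \<noteq> y" "\<beta> z \<noteq> \<beta> y" using \<beta>(2)[of z] \<beta>(2)[OF y] by auto
      then show ?thesis using \<beta>(1)[OF \<open>z \<in> Y\<close>] by (simp add: Y'_def)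
    qed
    let ?h = "\<lambda>g. g(x := y, \<alpha> x := \<beta> y)"
    have "{f \<in> B X Y. f x = y} = ?h ` B X' Y'"
    proof (intro equalityI subsetI)
      fix f assume f: "f \<in> {f \<in> B X Y. f x = y}"
      then have fb: "bij_betw f X Y" and fe: "\<forall>z\<in>X. f (\<alpha> z) = \<beta> (f z)" and fx: "f x = y"
        and fE: "f \<in> extensional X"
        by (auto simp: B_def PiE_def)
      have fax: "f (\<alpha> x) = \<beta> y" using fe x fx by auto
      have "f ` (X - {x, \<alpha> x}) = f ` X - f ` {x, \<alpha> x}"
        by (rule inj_on_image_set_diff[of f X]) (use fb x \<alpha>(1)[OF x] in \<open>auto simp: bij_betw_def\<close>)
      then have "f ` X' = Y'"
        using fb fx fax by (simp add: X'_def Y'_def bij_betw_def)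
      then have "bij_betw f X' Y'"
        by (intro bij_betw_subset[OF fb]) (simp_all add: X'_def)
      then have "restrict f X' \<in> B X' Y'"
        using fe \<alpha>' X by (auto simp: B_def bij_betw_def inj_on_def)
      moreover have "f = ?h (restrict f X')"
        using fx fax fE X(1) by (auto simp: fun_eq_iff extensional_def)
      ultimately show "f \<in> ?h ` B X' Y'"
        by (intro image_eqI[where f = ?h and x = "restrict f X'"])
    next
      fix f assume "f \<in> ?h ` B X' Y'"
      then obtain g where g: "g \<in> B X' Y'" "f = ?h g" by auto
      then have gb: "bij_betw g X' Y'" and ge: "\<forall>z\<in>X'. g (\<alpha> z) = \<beta> (g z)"
        and gE: "g \<in> extensional X'"
        by (auto simp: B_def PiE_def)
      have fx: "f x = y" "f (\<alpha> x) = \<beta> y" and fg: "\<And>z. z \<in> X' \<Longrightarrow> f z = g z"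
        using g(2) X \<alpha>(3)[OF x] by auto
      have im: "f ` X' = Y'" using gb fg by (auto simp: bij_betw_def)
      have "bij_betw f X' Y'" using gb fg by (simp cong: bij_betw_cong)
      then have "inj_on f X'" by (simp add: bij_betw_def)
      then have "inj_on f X"
        unfolding X(1) using fx im Y \<beta>(3)[OF y] X(2,3) by auto
      moreover have "f ` X = Y" unfolding X(1) Y(1) using fx im by auto
      moreover have "f \<in> extensional X"
        using gE unfolding g(2) X(1) by (auto simp: extensional_def)
      moreover have "f (\<alpha> z) = \<beta> (f z)" if zX: "z \<in> X" for z
      proof -
        consider "z = x" | "z = \<alpha> x" | "z \<in> X'" using zX X(1) by auto
        then show ?thesis
        proof cases
          case 3
          then show ?thesis using fg ge \<alpha>' by simp
        qed (use fx \<alpha>(2)[OF x] \<beta>(2)[OF y] in simp_all)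
      qed
      ultimately show "f \<in> {f \<in> B X Y. f x = y}"
        using fx by (auto simp: B_def bij_betw_def PiE_def)
    qed
    moreover have "inj_on ?h (B X' Y')"
    proof (rule inj_onI, rule ext)
      fix g g' z assume g: "g \<in> B X' Y'" "g' \<in> B X' Y'" and e: "?h g = ?h g'"
      show "g z = g' z"
      proof (cases "z = x \<or> z = \<alpha> x")
        case True
        then have "z \<notin> X'" using X by auto
        then show ?thesis using g by (auto simp: B_def PiE_def extensional_def)
      next
        case False
        then show ?thesis using fun_cong[OF e, of z] by simp
      qed
    qed
    ultimately have "card {f \<in> B X Y. f x = y} = card (B X' Y')"
      by (simp add: card_image)
    also have "\<dots> = 2 ^ n * fact n"
      unfolding B_def
    proof (rule Suc.IH)
      show "finite X'" "finite Y'" using Suc.prems by (auto simp: X'_def Y'_def)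
      show "card X' = 2 * n"
        using Suc.prems(1,3) X \<alpha>(3)[OF x] \<open>finite X'\<close> by simp
      show "card Y' = 2 * n"
        using Suc.prems(4,6) Y \<beta>(3)[OF y] \<open>finite Y'\<close> by simp
      show "\<alpha> z \<in> X' \<and> \<alpha> (\<alpha> z) = z \<and> \<alpha> z \<noteq> z" if "z \<in> X'" for z
        using \<alpha>'[OF that] \<alpha> that by (auto simp: X'_def)
      show "\<beta> z \<in> Y' \<and> \<beta> (\<beta> z) = z \<and> \<beta> z \<noteq> z" if "z \<in> Y'" for z
        using \<beta>'[OF that] \<beta> that by (auto simp: Y'_def)
    qed
    finally show ?thesis .
  qed
  have "B X Y = (\<Union>y\<in>Y. {f \<in> B X Y. f x = y})"
    using x by (auto simp: B_def PiE_def)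
  moreover have "finite (B X Y)"
    unfolding B_def using Suc.prems by (auto intro: finite_subset[OF _ finite_PiE[of X "\<lambda>_. Y"]])
  ultimately have "card (B X Y) = (\<Sum>y\<in>Y. card {f \<in> B X Y. f x = y})"
    using Suc.prems(4) by (subst \<open>B X Y = _\<close>, subst card_UN_disjoint) auto
  also have "\<dots> = 2 * Suc n * (2 ^ n * fact n)"
    using part Suc.prems(6) by simp
  finally show ?case by (simp add: B_def algebra_simps)
qed

section \<open>Transitivity in terms of invariant subsets\<close>

lemma faces_perm_apply:
  assumes "distinct (concat fs)" "f \<in> set fs" "x \<in> set f"
  shows "faces_perm fs x = cycle_of_list f x"
  using assms
proof (induction fs)
  case (Cons g fs)
  show ?case
  proof (cases "f = g")
    case True
    then have "x \<notin> set (concat fs)" using Cons.prems by auto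
    then show ?thesis using True faces_perm_outside[of x fs] by simp
  next
    case False
    then have f: "f \<in> set fs" using Cons.prems by simp
    have "cycle_of_list f x \<in> set f"
      using permutes_in_image[OF cycle_permutes] Cons.prems(3) by fast
    then have "cycle_of_list f x \<notin> set g" using Cons.prems f by auto
    moreover have "faces_perm fs x = cycle_of_list f x"
      using Cons.IH Cons.prems f by simp
    ultimately show ?thesis by (simp add: id_outside_supp)
  qed
qed simp

text \<open>A cycle is transitive on the letters of its word, so an invariant set contains each face
  that it meets. This connects \<open>linked\<close> with transitivity of a group.\<close>

lemma faces_perm_invariant_iff:
  assumes "distinct (concat fs)"
  shows "faces_perm fs ` A \<subseteq> A \<longleftrightarrow> (\<forall>f \<in> set fs. set f \<inter> A \<noteq> {} \<longrightarrow> set f \<subseteq> A)"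
proof (intro iffI ballI impI subsetI)
  fix f y assume inv: "faces_perm fs ` A \<subseteq> A" and f: "f \<in> set fs" "set f \<inter> A \<noteq> {}" "y \<in> set f"
  have d: "distinct f" using assms f(1) by (induction fs) auto
  obtain x where x: "x \<in> set f" "x \<in> A" using f by auto
  obtain i where i: "i < length f" "x = f ! i" using x by (metis in_set_conv_nth)
  obtain j where j: "j < length f" "y = f ! j" using f by (metis in_set_conv_nth)
  \<comment> \<open>Applying the cycle moves one position forward modulo the length; adding
    \<open>length f\<close> keeps the subtraction of \<open>i\<close> from being truncated.\<close>
  let ?n = "j + length f - i"
  have "(cycle_of_list f ^^ k) x \<in> A \<inter> set f" for k
  proof (induction k)
    case (Suc k)
    let ?z = "(cycle_of_list f ^^ k) x"
    have "cycle_of_list f ?z \<in> set f"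
      using permutes_in_image[OF cycle_permutes, of f ?z] Suc by auto
    moreover have "cycle_of_list f ?z \<in> A"
      using faces_perm_apply[OF assms f(1), of ?z] inv Suc by auto
    ultimately show ?case by simp
  qed (use x in simp)
  moreover have "(cycle_of_list f ^^ ?n) x = y"
  proof -
    have "(cycle_of_list f ^^ ?n) x = map (cycle_of_list f ^^ ?n) f ! i" using i by simp
    also have "\<dots> = rotate ?n f ! i" by (simp only: cyclic_rotation[OF d])
    also have "\<dots> = f ! ((?n + i) mod length f)" using i by (simp add: nth_rotate)
    also have "?n + i = j + length f" using i by simp
    finally show ?thesis using j by simp
  qed
  ultimately show "y \<in> A" by blast
next
  fix y assume u: "\<forall>f \<in> set fs. set f \<inter> A \<noteq> {} \<longrightarrow> set f \<subseteq> A" and "y \<in> faces_perm fs ` A"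
  then obtain x where x: "x \<in> A" "y = faces_perm fs x" by auto
  show "y \<in> A"
  proof (cases "x \<in> set (concat fs)")
    case True
    then obtain f where f: "f \<in> set fs" "x \<in> set f" by auto
    then have "y \<in> set f"
      using permutes_in_image[OF cycle_permutes, of f x] faces_perm_apply[OF assms f] x by simp
    moreover have "set f \<subseteq> A" using u f x by auto
    ultimately show ?thesis by auto
  next
    case False
    then show ?thesis using x faces_perm_outside by metis
  qed
qed

text \<open>The orbit of a point is an invariant set, and conversely a set invariant under the
  generators is invariant under the whole group. Inverses are harmless because the set is
  finite.\<close>

lemma generate_transitive_iff:
  assumes "p permutes {1..n}" "q permutes {1..n}"
  shows "(\<forall>x \<in> {1..n}. \<forall>y \<in> {1..n}. \<exists>\<sigma> \<in> generate (sym_group n) {p, q}. \<sigma> x = y) \<longleftrightarrow>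
    (\<forall>A \<subseteq> {1..n}. p ` A \<subseteq> A \<longrightarrow> q ` A \<subseteq> A \<longrightarrow> A = {} \<or> A = {1..n})" (is "?L \<longleftrightarrow> ?R")
proof
  assume L: ?L
  show ?R
  proof (intro allI impI)
    fix A assume A: "A \<subseteq> {1..n}" "p ` A \<subseteq> A" "q ` A \<subseteq> A"
    \<comment> \<open>An injection of a finite set into itself is onto, so the inverse preserves the
      set as well.\<close>
    have inv: "inv' h ` A \<subseteq> A" if "h \<in> {p, q}" for h
    proof -
      have "inj h" "h ` A \<subseteq> A" using that A assms permutes_inj by auto
      then have "h ` A = A"
        using A(1) by (intro endo_inj_surj) (auto intro: finite_subset inj_on_subset)
      then have "inv' h ` A = inv' h ` h ` A" by simp
      also have "\<dots> = A" using \<open>inj h\<close> by (simp add: image_image)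
      finally show ?thesis by simp
    qed
    have "\<sigma> ` A \<subseteq> A" if "\<sigma> \<in> generate (sym_group n) {p, q}" for \<sigma>
      using that
    proof induction
      case one
      show ?case by (simp add: sym_group_one)
    next
      case (incl h)
      then show ?case using A by auto
    next
      case (inv h)
      then have "inv\<^bsub>sym_group n\<^esub> h = inv' h"
        using assms by (intro sym_group_inv_equality) (auto simp: sym_group_carrier)
      then show ?case using \<open>h \<in> {p, q}\<close> \<open>\<And>h. h \<in> {p, q} \<Longrightarrow> inv' h ` A \<subseteq> A\<close> by metis
    next
      case (eng h1 h2)
      then show ?case by (auto simp: sym_group_mult)
    qed
    then have "y \<in> A" if "x \<in> A" "y \<in> {1..n}" for x y
      using L that A(1) by (metis image_subset_iff subsetD)
    then show "A = {} \<or> A = {1..n}" using A(1) by blast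
  qed
next
  assume R: ?R
  show ?L
  proof (intro ballI)
    fix x y assume x: "x \<in> {1..n}" and y: "y \<in> {1..n}"
    define A where "A = (\<lambda>\<sigma>. \<sigma> x) ` generate (sym_group n) {p, q}"
    have closed: "h ` A \<subseteq> A" if "h \<in> {p, q}" for h
    proof
      fix z assume "z \<in> h ` A"
      then obtain \<sigma> where s: "\<sigma> \<in> generate (sym_group n) {p, q}" "z = h (\<sigma> x)"
        by (auto simp: A_def)
      have "h \<circ> \<sigma> \<in> generate (sym_group n) {p, q}"
        using generate.eng[OF generate.incl[OF that] s(1)] by (simp add: sym_group_mult)
      then show "z \<in> A" unfolding A_def by (rule rev_image_eqI) (simp add: s(2))
    qed
    have "id \<in> generate (sym_group n) {p, q}"
      using generate.one[of "sym_group n"] by (simp add: sym_group_one)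
    then have "x \<in> A" unfolding A_def by (rule rev_image_eqI) simp
    moreover have "A \<subseteq> {1..n}"
    proof -
      have "generate (sym_group n) {p, q} \<subseteq> carrier (sym_group n)"
        using assms by (intro group.generate_incl[OF sym_group_is_group]) (auto simp: sym_group_carrier)
      then have "\<sigma> x \<in> {1..n}" if "\<sigma> \<in> generate (sym_group n) {p, q}" for \<sigma>
        using that x permutes_in_image[of \<sigma> "{1..n}" x] sym_group_carrier[of \<sigma> n] by blast
      then show ?thesis unfolding A_def by (rule image_subsetI)
    qed
    ultimately have "A = {1..n}" using R closed[of p] closed[of q] by blast
    then have "y \<in> A" using y by simp
    then show "\<exists>\<sigma> \<in> generate (sym_group n) {p, q}. \<sigma> x = y"
      unfolding A_def by blast
  qed
qed

lemma invariant_subsets_transport: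
  assumes f: "bij_betw f X Y"
    and p: "\<And>x. x \<in> X \<Longrightarrow> p x \<in> X \<and> p' (f x) = f (p x)"
    and q: "\<And>x. x \<in> X \<Longrightarrow> q x \<in> X \<and> q' (f x) = f (q x)"
  shows "(\<forall>A \<subseteq> Y. p' ` A \<subseteq> A \<longrightarrow> q' ` A \<subseteq> A \<longrightarrow> A = {} \<or> A = Y) \<longleftrightarrow>
    (\<forall>A \<subseteq> X. p ` A \<subseteq> A \<longrightarrow> q ` A \<subseteq> A \<longrightarrow> A = {} \<or> A = X)" (is "?L \<longleftrightarrow> ?R")
proof
  assume L: ?L
  show ?R
  proof (intro allI impI)
    fix A assume A: "A \<subseteq> X" "p ` A \<subseteq> A" "q ` A \<subseteq> A"
    have "p' ` f ` A \<subseteq> f ` A"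
    proof
      fix y assume "y \<in> p' ` f ` A"
      then obtain x where x: "x \<in> A" "y = p' (f x)" by auto
      then have "y = f (p x)" "p x \<in> A" using A p by auto
      then show "y \<in> f ` A" by simp
    qed
    moreover have "q' ` f ` A \<subseteq> f ` A"
    proof
      fix y assume "y \<in> q' ` f ` A"
      then obtain x where x: "x \<in> A" "y = q' (f x)" by auto
      then have "y = f (q x)" "q x \<in> A" using A q by auto
      then show "y \<in> f ` A" by simp
    qed
    moreover have "f ` A \<subseteq> Y" using f A by (auto simp: bij_betw_def)
    ultimately have "f ` A = {} \<or> f ` A = Y" using L by blast
    then show "A = {} \<or> A = X"
      using f A(1) by (metis bij_betw_def empty_is_image inj_on_image_eq_iff subset_refl)
  qed
next
  assume R: ?R
  show ?L
  proof (intro allI impI)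
    fix B assume B: "B \<subseteq> Y" "p' ` B \<subseteq> B" "q' ` B \<subseteq> B"
    define A where "A = {x \<in> X. f x \<in> B}"
    have "f ` A = B" using f B(1) by (force simp: A_def bij_betw_def)
    have "p x \<in> A" "q x \<in> A" if "x \<in> A" for x
    proof -
      have x: "x \<in> X" "f x \<in> B" using that by (simp_all add: A_def)
      then have "p' (f x) \<in> B" "q' (f x) \<in> B" using B(2,3) by blast+
      then show "p x \<in> A" "q x \<in> A" using p[OF x(1)] q[OF x(1)] by (simp_all add: A_def)
    qed
    then have "p ` A \<subseteq> A" "q ` A \<subseteq> A" by (simp_all add: image_subset_iff)
    moreover have "A \<subseteq> X" by (simp add: A_def)
    ultimately have "A = {} \<or> A = X" using R by simp
    then show "B = {} \<or> B = Y" using \<open>f ` A = B\<close> f by (auto simp: bij_betw_def)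
  qed
qed

section \<open>The correspondence between gluing data and lists of faces\<close>

definition blocks :: "nat list \<Rightarrow> nat list list" where
  "blocks ms = map (\<lambda>i. [partial_sum ms i + 1 ..< partial_sum ms (i + 1) + 1]) [0..<length ms]"

lemma face_perm_blocks: "face_perm ms = faces_perm (blocks ms)"
  unfolding face_perm_def faces_perm_def blocks_def by (simp add: foldr_map comp_def)

lemma map_length_blocks: "map length (blocks ms) = ms"
proof (rule nth_equalityI)
  fix i assume "i < length (map length (blocks ms))"
  then have "i < length ms" by (simp add: blocks_def)
  then show "map length (blocks ms) ! i = ms ! i"
    by (simp add: blocks_def partial_sum_def take_Suc_conv_app_nth)
qed (simp add: blocks_def)

lemma concat_blocks: "concat (blocks ms) = [1..<sum_list ms + 1]"
proof -
  have "concat (map (\<lambda>i. [partial_sum ms i + 1 ..< partial_sum ms (i + 1) + 1]) [0..<k])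
      = [1..<partial_sum ms k + 1]" for k
  proof (induction k)
    case (Suc k)
    have "partial_sum ms k \<le> partial_sum ms (Suc k)" by (rule partial_sum_mono) simp
    then have "[1..<partial_sum ms k + 1] @ [partial_sum ms k + 1..<partial_sum ms (k + 1) + 1]
        = [1..<partial_sum ms (Suc k) + 1]"
      using upt_add_eq_append[of 1 "partial_sum ms k + 1" "partial_sum ms (Suc k) - partial_sum ms k"]
      by simp
    then show ?case using Suc by simp
  qed (simp add: partial_sum_def)
  from this[of "length ms"] show ?thesis by (simp add: blocks_def partial_sum_def)
qed

lemma concat_map_length_inject:
  "concat xs = concat ys \<Longrightarrow> map length xs = map length ys \<Longrightarrow> xs = ys"
proof (induction xs arbitrary: ys)
  case (Cons x xs)
  then show ?case by (cases ys) auto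
qed simp

text \<open>The labelling carries \<open>face_perm ms\<close> to the product of the face cycles and
  \<iota> to \<open>opp\<close>; cycle counts and invariant subsets are transported along
  it.\<close>

lemma maps_iff_datum:
  assumes d: "(ms, \<iota>) \<in> gluing_data N K" and N: "0 < N" "1 \<le> K" "finite E" "card E = N"
    and f: "bij_betw f {1..2 * N} (E \<times> UNIV)" "\<And>x. x \<in> {1..2 * N} \<Longrightarrow> f (\<iota> x) = opp (f x)"
  shows "map (map f) (blocks ms) \<in> rooted_maps E K g \<longleftrightarrow>
    connected_datum N (ms, \<iota>) \<and> genus_datum g N K (ms, \<iota>)"
proof -
  let ?fs = "map (map f) (blocks ms)" and ?X = "{1..2 * N}"
  have ms: "length ms = K" "sum_list ms = 2 * N" "0 \<notin> set ms"
    and \<iota>: "\<iota> permutes ?X"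
    using d by (auto simp: gluing_data_def)
  have cb: "concat (blocks ms) = [1..<2 * N + 1]" using concat_blocks ms by simp
  have X: "set (concat (blocks ms)) = ?X" unfolding cb by auto
  have cf: "concat ?fs = map f [1..<2 * N + 1]" by (simp only: cb map_concat[symmetric])
  have len: "length ?fs = K" using ms(1) by (simp add: blocks_def)
  have cov: "covers E ?fs"
    using f(1) X distinct_upt unfolding covers_def cf distinct_map set_map cb bij_betw_def by simp
  \<comment> \<open>Positive parts give no empty words, so the count of empty faces in
    \<open>vertices\<close> vanishes and the last conjunct of \<open>linked\<close> holds.\<close>
  have ne: "[] \<notin> set ?fs"
  proof
    assume "[] \<in> set ?fs"
    then have "[] \<in> set (blocks ms)" by auto
    then have "length ([] :: nat list) \<in> set (map length (blocks ms))" unfolding set_map by (rule imageI)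
    then show False using ms(3) map_length_blocks[of ms] by simp
  qed
  have fp: "face_perm ms permutes ?X" using face_perm_permutes[of ms] ms by simp
  have pf: "faces_perm ?fs (f x) = f (face_perm ms x)" if "x \<in> ?X" for x
    unfolding face_perm_blocks
    by (rule faces_perm_map[of f ?X]) (use f(1) X that in \<open>auto simp: bij_betw_def\<close>)
  have fX: "f x \<in> E \<times> UNIV" if "x \<in> ?X" for x using bij_betwE[OF f(1)] that by blast
  have "cycles_on (faces_perm ?fs \<circ> opp_on E) (E \<times> UNIV) = cycles_on (face_perm ms \<circ> \<iota>) ?X"
  proof (rule cycles_on_conj[OF f(1)])
    show "face_perm ms \<circ> \<iota> permutes ?X" by (rule permutes_compose[OF \<iota> fp])
    fix x assume x: "x \<in> ?X"
    have "opp_on E (f x) = f (\<iota> x)" using fX[OF x] f(2)[OF x] by (auto simp: opp_on_def)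
    then show "(faces_perm ?fs \<circ> opp_on E) (f x) = f ((face_perm ms \<circ> \<iota>) x)"
      using pf[of "\<iota> x"] permutes_in_image[OF \<iota>, of x] x by (simp del: atLeastAtMost_iff)
  qed simp
  then have V: "vertices E ?fs = num_cycles (2 * N) (face_perm ms \<circ> \<iota>)"
    using ne by (simp add: vertices_def num_cycles_def cycles_on_def count_list_0_iff)
  have "linked E ?fs \<longleftrightarrow> (\<forall>A \<subseteq> E \<times> UNIV. opp ` A \<subseteq> A \<longrightarrow> faces_perm ?fs ` A \<subseteq> A \<longrightarrow>
      A = {} \<or> A = E \<times> UNIV)"
    unfolding linked_def using ne faces_perm_invariant_iff[of ?fs] cov unfolding covers_def by simp
  also have "\<dots> \<longleftrightarrow> (\<forall>A \<subseteq> ?X. \<iota> ` A \<subseteq> A \<longrightarrow> face_perm ms ` A \<subseteq> A \<longrightarrow> A = {} \<or> A = ?X)"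
  proof (rule invariant_subsets_transport[OF f(1)])
    fix x assume x: "x \<in> ?X"
    show "\<iota> x \<in> ?X \<and> opp (f x) = f (\<iota> x)"
      using f(2)[OF x] permutes_in_image[OF \<iota>, of x] x by simp
    show "face_perm ms x \<in> ?X \<and> faces_perm ?fs (f x) = f (face_perm ms x)"
      using pf[OF x] permutes_in_image[OF fp, of x] x by simp
  qed
  also have "\<dots> \<longleftrightarrow> connected_datum N (ms, \<iota>)"
    unfolding connected_datum_def prod.case by (rule generate_transitive_iff[OF \<iota> fp, symmetric])
  finally have "linked E ?fs \<longleftrightarrow> connected_datum N (ms, \<iota>)" .
  moreover have "vertices E ?fs + K + 2 * g = card E + 2 \<longleftrightarrow> genus_datum g N K (ms, \<iota>)"
    unfolding genus_datum_def prod.case V N(4) by linarith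
  ultimately show ?thesis using len cov by (simp add: rooted_maps_def)
qed

text \<open>A list of faces returns its datum and labelling: the lengths form the composition, the
  concatenated word is the labelling, and \<iota> is \<open>opp\<close> pulled back along it.
  Without edges there are no darts, and the convention in \<open>eps\<close> has to be matched
  separately.\<close>

lemma card_maps_eps:
  assumes "finite E" "card E = N" "1 \<le> K"
  shows "card (rooted_maps E K g) = 2 ^ N * fact N * eps g N K"
proof (cases "N = 0")
  case True
  then have E: "E = {}" using assms by auto
  have rep: "length fs = K \<and> covers {} fs \<longleftrightarrow> fs = replicate K []" for fs :: "dart list list"
    unfolding covers_def by (auto intro: replicate_eqI)
  have lk: "linked {} (replicate K []) \<longleftrightarrow> K = 1"
    using assms(3) by (auto simp: linked_def)
  have mem: "fs \<in> rooted_maps {} K g \<longleftrightarrow> K = 1 \<and> g = 0 \<and> fs = [[]]" for fs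
  proof -
    have "fs \<in> rooted_maps {} K g \<longleftrightarrow>
      fs = replicate K [] \<and> linked {} fs \<and> vertices {} fs + K + 2 * g = 2"
      unfolding rooted_maps_def rep[symmetric] by auto
    also have "\<dots> \<longleftrightarrow> fs = replicate K [] \<and> K = 1 \<and> vertices {} fs + K + 2 * g = 2"
      using lk by metis
    \<comment> \<open>The empty word counts as one vertex, so Euler's relation reads 1 + 1 + 2g = 2
      and forces genus 0.\<close>
    also have "\<dots> \<longleftrightarrow> K = 1 \<and> g = 0 \<and> fs = [[]]"
      by (auto simp: vertices_def)
    finally show ?thesis .
  qed
  have "rooted_maps E K g = (if K = 1 \<and> g = 0 then {[[]]} else {})"
    unfolding E by (simp add: set_eq_iff mem)
  then show ?thesis using True by (simp add: eps_def)
next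
  case False
  let ?X = "{1..2 * N}"
  define D where "D = {d \<in> gluing_data N K. connected_datum N d \<and> genus_datum g N K d}"
  define B where "B = (\<lambda>d :: nat list \<times> (nat \<Rightarrow> nat).
    {f \<in> ?X \<rightarrow>\<^sub>E (E \<times> UNIV). bij_betw f ?X (E \<times> UNIV) \<and> (\<forall>x \<in> ?X. f (snd d x) = opp (f x))})"
  let ?h = "\<lambda>(d :: nat list \<times> (nat \<Rightarrow> nat), f :: nat \<Rightarrow> dart). map (map f) (blocks (fst d))"
  have finD: "finite D" unfolding D_def using finite_gluing_data by simp
  have cardE: "card (E \<times> (UNIV :: bool set)) = 2 * N" using assms by (simp add: card_cartesian_product)
  have cardB: "card (B d) = 2 ^ N * fact N" if "d \<in> D" for d
  proof -
    obtain ms \<iota> where d: "d = (ms, \<iota>)" by (cases d)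
    have \<iota>: "\<iota> permutes ?X" "\<iota> \<circ> \<iota> = id" "\<forall>x\<in>?X. \<iota> x \<noteq> x"
      using that by (auto simp: D_def d gluing_data_def)
    show ?thesis
      unfolding B_def d snd_conv
    proof (rule card_equivariant_bijections)
      show "\<iota> x \<in> ?X \<and> \<iota> (\<iota> x) = x \<and> \<iota> x \<noteq> x" if "x \<in> ?X" for x
        using permutes_in_image[OF \<iota>(1), of x] fun_cong[OF \<iota>(2), of x] \<iota>(3) that by simp
      show "opp y \<in> E \<times> UNIV \<and> opp (opp y) = y \<and> opp y \<noteq> y" if "y \<in> E \<times> UNIV" for y
        using that by (simp add: mem_Times_iff)
    qed (use assms cardE in auto)
  qed
  have "rooted_maps E K g = ?h ` Sigma D B"
  proof (intro equalityI subsetI)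
    fix fs assume "fs \<in> ?h ` Sigma D B"
    then obtain d f where df: "d \<in> D" "f \<in> B d" "fs = map (map f) (blocks (fst d))"
      by auto
    obtain ms \<iota> where d: "d = (ms, \<iota>)" by (cases d)
    show "fs \<in> rooted_maps E K g"
      using maps_iff_datum[of ms \<iota> N K E f g] df False assms by (auto simp: D_def B_def d)
  next
    fix fs assume fs: "fs \<in> rooted_maps E K g"
    then have cov: "covers E fs" and len: "length fs = K" and lk: "linked E fs" by (auto simp: rooted_maps_def)
    have lc: "length (concat fs) = 2 * N" using covers_length[OF cov assms(1)] assms(2) by simp
    have ne: "[] \<notin> set fs"
    proof (cases "length fs = 1")
      case True
      then obtain l where "fs = [l]" by (auto simp: length_Suc_conv)
      then show ?thesis using lc False by auto
    next
      case False
      then show ?thesis using lk by (simp add: linked_def)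
    qed
    define ms where "ms = map length fs"
    define f where "f = (\<lambda>i\<in>?X. concat fs ! (i - 1))"
    have bl: "map (map f) (blocks ms) = fs"
    proof (rule concat_map_length_inject)
      have sl: "sum_list ms = 2 * N" using lc by (simp add: ms_def length_concat)
      have "concat (map (map f) (blocks ms)) = map f [1..<2 * N + 1]"
        using concat_blocks[of ms] by (simp only: sl map_concat[symmetric])
      also have "\<dots> = concat fs"
        by (rule nth_equalityI) (use lc in \<open>auto simp: f_def nth_upt simp del: upt_Suc\<close>)
      finally show "concat (map (map f) (blocks ms)) = concat fs" .
      show "map length (map (map f) (blocks ms)) = map length fs"
        using map_length_blocks[of ms] by (simp add: ms_def comp_def)
    qed
    have fb: "bij_betw f ?X (E \<times> UNIV)"
    proof -
      have "bij_betw (\<lambda>i. concat fs ! i) {..<2 * N} (E \<times> UNIV)"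
        using bij_betw_nth[of "concat fs"] cov lc by (simp add: covers_def)
      moreover have "bij_betw (\<lambda>i. i - 1) ?X {..<2 * N}"
        by (rule bij_betw_byWitness[where f' = "\<lambda>i. i + 1"]) auto
      ultimately have "bij_betw ((\<lambda>i. concat fs ! i) \<circ> (\<lambda>i. i - 1)) ?X (E \<times> UNIV)"
        using bij_betw_trans by blast
      then show ?thesis
        by (rule bij_betw_cong[THEN iffD1, rotated]) (simp add: f_def)
    qed
    \<comment> \<open>Outside \<open>?X\<close> the involution must be the identity, as
      \<open>permutes\<close> demands.\<close>
    define \<iota> where "\<iota> = (\<lambda>i. if i \<in> ?X then inv_into ?X f (opp (f i)) else i)"
    have fX: "opp (f i) \<in> E \<times> UNIV" if "i \<in> ?X" for i
    proof -
      have "f i \<in> E \<times> UNIV" using bij_betwE[OF fb] that by blast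
      then show ?thesis by (simp add: mem_Times_iff)
    qed
    have \<iota>X: "\<iota> i \<in> ?X" "f (\<iota> i) = opp (f i)" if "i \<in> ?X" for i
    proof -
      have "opp (f i) \<in> f ` ?X" using fX[OF that] bij_betw_imp_surj_on[OF fb] by (simp only:)
      moreover have "\<iota> i = inv_into ?X f (opp (f i))" using that by (simp only: \<iota>_def if_True)
      ultimately show "\<iota> i \<in> ?X" "f (\<iota> i) = opp (f i)"
        using inv_into_into f_inv_into_f by metis+
    qed
    have inj: "i = j" if "i \<in> ?X" "j \<in> ?X" "f i = f j" for i j
      using bij_betw_imp_inj_on[OF fb] that by (meson inj_onD)
    have \<iota>\<iota>: "\<iota> (\<iota> i) = i" for i
    proof (cases "i \<in> ?X")
      case True
      then show ?thesis by (intro inj) (use \<iota>X in \<open>simp_all del: atLeastAtMost_iff\<close>)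
    next
      case False
      then show ?thesis by (simp add: \<iota>_def del: atLeastAtMost_iff)
    qed
    have "bij_betw \<iota> ?X ?X"
      by (rule bij_betw_byWitness[where f' = \<iota>]) (use \<iota>X \<iota>\<iota> in blast)+
    then have "\<iota> permutes ?X"
      by (rule bij_imp_permutes) (simp add: \<iota>_def del: atLeastAtMost_iff)
    moreover have "\<iota> i \<noteq> i" if "i \<in> ?X" for i
      using \<iota>X(2)[OF that] by (metis opp_neq(1))
    moreover have "\<forall>m \<in> set ms. 0 < m" using ne by (auto simp: ms_def)
    moreover have "\<iota> \<circ> \<iota> = id" using \<iota>\<iota> by auto
    ultimately have gd: "(ms, \<iota>) \<in> gluing_data N K"
      using len lc by (simp add: gluing_data_def ms_def length_concat)
    have "(ms, \<iota>) \<in> D"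
      using maps_iff_datum[OF gd _ assms(3,1,2) fb \<iota>X(2), of g] fs bl False gd by (simp add: D_def)
    moreover have "f \<in> B (ms, \<iota>)"
      using fb \<iota>X(2) by (auto simp: B_def bij_betw_def f_def)
    ultimately have "((ms, \<iota>), f) \<in> Sigma D B" by simp
    then show "fs \<in> ?h ` Sigma D B" by (rule rev_image_eqI) (simp add: bl)
  qed
  moreover have "inj_on ?h (Sigma D B)"
  proof (rule inj_onI)
    fix x y assume x: "x \<in> Sigma D B" and y: "y \<in> Sigma D B" and e: "?h x = ?h y"
    obtain ms \<iota> f where x': "x = ((ms, \<iota>), f)" by (metis prod.exhaust)
    obtain ms' \<iota>' f' where y': "y = ((ms', \<iota>'), f')" by (metis prod.exhaust)
    have e': "map (map f) (blocks ms) = map (map f') (blocks ms')" using e by (simp add: x' y')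
    have gd: "(ms, \<iota>) \<in> gluing_data N K" "(ms', \<iota>') \<in> gluing_data N K"
      using x y by (auto simp: x' y' D_def)
    have fE: "f \<in> extensional ?X" "f' \<in> extensional ?X" and fb: "bij_betw f ?X (E \<times> UNIV)"
      and fe: "\<forall>i\<in>?X. f (\<iota> i) = opp (f i)" "\<forall>i\<in>?X. f' (\<iota>' i) = opp (f' i)"
      using x y by (auto simp: x' y' B_def PiE_def)
    \<comment> \<open>Lengths give back \<open>ms\<close>, the letters in order give back
      \<open>f\<close>, and injectivity of \<open>f\<close> then recovers \<iota> from
      \<open>opp\<close>.\<close>
    have "map length (map (map f) (blocks ms)) = map length (map (map f') (blocks ms'))"
      by (simp only: e')
    then have ms: "ms = ms'"
      using map_length_blocks[of ms] map_length_blocks[of ms'] by (simp add: comp_def)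
    have "map f (concat (blocks ms)) = map f' (concat (blocks ms))"
      using e' unfolding ms by (metis map_concat)
    moreover have "concat (blocks ms) = [1..<2 * N + 1]"
      using concat_blocks[of ms] gd by (simp add: gluing_data_def)
    ultimately have "f i = f' i" if "i \<in> ?X" for i using that by (simp del: upt_Suc)
    then have f: "f = f'" using fE by (rule extensionalityI[rotated 2])
    have "\<iota> i = \<iota>' i" for i
    proof (cases "i \<in> ?X")
      case True
      have "\<iota> i \<in> ?X" "\<iota>' i \<in> ?X"
        using gd True permutes_in_image[of \<iota> ?X i] permutes_in_image[of \<iota>' ?X i]
        by (simp_all add: gluing_data_def)
      moreover have "f (\<iota> i) = f (\<iota>' i)" using fe f True by metis
      ultimately show ?thesis using bij_betw_imp_inj_on[OF fb] by (meson inj_onD)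
    next
      case False
      then show ?thesis using gd permutes_not_in[of \<iota> ?X i] permutes_not_in[of \<iota>' ?X i]
        by (simp add: gluing_data_def del: atLeastAtMost_iff)
    qed
    then show "x = y" using ms f by (simp add: x' y' fun_eq_iff)
  qed
  ultimately have "card (rooted_maps E K g) = card (Sigma D B)"
    by (simp add: card_image)
  also have "\<dots> = (\<Sum>d\<in>D. 2 ^ N * fact N)"
  proof (subst card_SigmaI)
    have "card (B d) \<noteq> 0" if "d \<in> D" for d using cardB[OF that] by simp
    then show "\<forall>d\<in>D. finite (B d)" by (metis card.infinite)
  qed (use finD cardB in simp_all)
  finally show ?thesis using False by (simp add: eps_def D_def)
qed

section \<open>The recursion\<close>

lemma sum_Pow_card:
  fixes h :: "nat \<Rightarrow> nat"
  assumes "finite A"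
  shows "(\<Sum>F\<in>Pow A. h (card F)) = (\<Sum>i\<le>card A. (card A choose i) * h i)"
proof -
  have "(\<Sum>F\<in>Pow A. h (card F)) = (\<Sum>i\<le>card A. \<Sum>F | F \<in> Pow A \<and> card F = i. h (card F))"
    using assms by (intro sum.group[symmetric]) (auto intro: card_mono)
  also have "\<dots> = (\<Sum>i\<le>card A. (card A choose i) * h i)"
    using n_subsets[OF assms] by (intro sum.cong) simp_all
  finally show ?thesis .
qed

text \<open>The binomial coefficient distributes the edge names over two components. It turns the
  product of their labelling factors into the factor for all \<open>n\<close> edges.\<close>

lemma choose_mult_labellings:
  fixes a b :: nat
  assumes "i \<le> n"
  shows "(n choose i) * (2 ^ i * fact i * a * (2 ^ (n - i) * fact (n - i) * b)) = 2 ^ n * fact n * (a * b)"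
proof -
  have "(2 :: nat) ^ n = 2 ^ i * 2 ^ (n - i)" using assms by (simp flip: power_add)
  moreover have "(fact n :: nat) = fact i * fact (n - i) * (n choose i)"
    using binomial_fact_lemma[OF assms] by simp
  ultimately show ?thesis by simp
qed

text \<open>With one edge, Euler's relation for genus 1 would leave no vertex for one face and has
  no solution for two faces, but there is always at least one vertex.\<close>

lemma eps_genus_one_small: "eps 1 1 1 = 0" "eps 1 1 2 = 0" "eps 1 0 K = 0"
proof -
  have "vertices {0} fs > 0" for fs :: "dart list list"
    unfolding vertices_def by (intro add_pos_nonneg cycles_on_pos) auto
  then have "vertices {0} fs \<noteq> 0" for fs by simp
  then have "rooted_maps {0} 1 1 = {}" "rooted_maps {0} 2 1 = {}"
    by (auto simp: rooted_maps_def)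
  then show "eps 1 1 1 = 0" "eps 1 1 2 = 0"
    using card_maps_eps[of "{0}" 1 1 1] card_maps_eps[of "{0}" 1 2 1] by simp_all
qed (simp add: eps_def)

text \<open>Each of the \<open>2 * N\<close> root darts contributes \<open>2 ^ M * fact M\<close>
  times the right-hand side; the total factor is \<open>2 ^ N * fact N\<close>, the number of
  labellings, and cancels.\<close>

lemma eps_genus_one_pair:
  assumes "N = Suc M"
  shows "eps 1 N 2 = N * (2 * N - 1) * eps 1 M 1 + eps 0 M 3
    + 2 * (\<Sum>i\<le>M. eps 0 i 1 * eps 1 (M - i) 2 + eps 1 i 1 * eps 0 (M - i) 2)" (is "_ = ?R")
proof -
  define E where "E = {..<N}"
  have E: "finite E" "card E = N" by (simp_all add: E_def)
  have part: "N * (2 * N - 1) * card (rooted_maps (E - {fst r}) 1 1) + card (rooted_maps (E - {fst r}) 3 0)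
      + 2 * (\<Sum>F\<in>Pow (E - {fst r}). card (rooted_maps F 1 0) * card (rooted_maps (E - {fst r} - F) 2 1)
        + card (rooted_maps F 1 1) * card (rooted_maps (E - {fst r} - F) 2 0)) = 2 ^ M * fact M * ?R"
    if "r \<in> E \<times> (UNIV :: bool set)" for r
  proof -
    define A where "A = E - {fst r}"
    have A: "finite A" "card A = M" using that E assms by (auto simp: A_def)
    let ?c = "\<lambda>n. 2 ^ n * fact n :: nat"
    define h where "h = (\<lambda>i. ?c i * eps 0 i 1 * (?c (M - i) * eps 1 (M - i) 2)
      + ?c i * eps 1 i 1 * (?c (M - i) * eps 0 (M - i) 2))"
    have "(\<Sum>F\<in>Pow A. card (rooted_maps F 1 0) * card (rooted_maps (A - F) 2 1)
        + card (rooted_maps F 1 1) * card (rooted_maps (A - F) 2 0)) = (\<Sum>F\<in>Pow A. h (card F))"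
    proof (rule sum.cong[OF refl])
      fix F assume F: "F \<in> Pow A"
      then have fin: "finite F" "finite (A - F)" using A finite_subset by auto
      have "card (A - F) = M - card F" using F fin A by (simp add: card_Diff_subset)
      then show "card (rooted_maps F 1 0) * card (rooted_maps (A - F) 2 1)
        + card (rooted_maps F 1 1) * card (rooted_maps (A - F) 2 0) = h (card F)"
        using card_maps_eps[OF fin(1) refl] card_maps_eps[OF fin(2) refl] by (simp add: h_def)
    qed
    also have "\<dots> = (\<Sum>i\<le>M. (M choose i) * h i)"
      using sum_Pow_card[OF A(1)] A(2) by simp
    also have "\<dots> = (\<Sum>i\<le>M. ?c M * (eps 0 i 1 * eps 1 (M - i) 2 + eps 1 i 1 * eps 0 (M - i) 2))"
    proof (rule sum.cong[OF refl])
      fix i assume "i \<in> {..M}"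
      then have "i \<le> M" by simp
      show "(M choose i) * h i = ?c M * (eps 0 i 1 * eps 1 (M - i) 2 + eps 1 i 1 * eps 0 (M - i) 2)"
        unfolding h_def distrib_left choose_mult_labellings[OF \<open>i \<le> M\<close>] ..
    qed
    finally have S: "(\<Sum>F\<in>Pow A. card (rooted_maps F 1 0) * card (rooted_maps (A - F) 2 1)
        + card (rooted_maps F 1 1) * card (rooted_maps (A - F) 2 0))
      = ?c M * (\<Sum>i\<le>M. eps 0 i 1 * eps 1 (M - i) 2 + eps 1 i 1 * eps 0 (M - i) 2)"
      by (simp only: sum_distrib_left)
    have "card (rooted_maps A 1 1) = ?c M * eps 1 M 1" "card (rooted_maps A 3 0) = ?c M * eps 0 M 3"
      by (rule card_maps_eps[OF A]; simp)+
    then show ?thesis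
      unfolding A_def[symmetric] S by (simp only: distrib_left mult_ac)
  qed
  have "2 ^ N * fact N * eps 1 N 2 = card (rooted_maps E 2 1)"
    using card_maps_eps[OF E, of 2 1] by simp
  also have "\<dots> = (\<Sum>r \<in> E \<times> (UNIV :: bool set). 2 ^ M * fact M * ?R)"
    unfolding card_maps_pair[OF E(1) E(2)[symmetric]] by (rule sum.cong[OF refl part])
  also have "\<dots> = 2 ^ N * fact N * ?R"
  proof -
    have "card (E \<times> (UNIV :: bool set)) = 2 * N" using E by (simp add: card_cartesian_product)
    then have "(\<Sum>r \<in> E \<times> (UNIV :: bool set). 2 ^ M * fact M * ?R) = 2 * N * (2 ^ M * fact M * ?R)"
      by (simp only: sum_constant of_nat_id)
    also have "\<dots> = 2 * 2 ^ M * (N * fact M) * ?R" by (simp only: mult_ac)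
    also have "\<dots> = 2 ^ N * fact N * ?R" unfolding assms by simp
    finally show ?thesis .
  qed
  finally show ?thesis by simp
qed

theorem theorem7:
  fixes N :: nat
  assumes "3 \<le> N"
  shows "eps 1 N 2 =
    2 * (\<Sum>i = 0..N - 3. eps_one 0 i * eps 1 (N - i - 1) 2 + eps 0 i 2 * eps_one 1 (N - i - 1))
    + N * (2 * N - 1) * eps_one 1 (N - 1) + eps 0 (N - 1) 3"
proof -
  obtain k where k: "N = k + 3" using assms by (metis add.commute le_Suc_ex)
  define M where "M = Suc (Suc k)"
  let ?g = "\<lambda>i. eps 0 i 1 * eps 1 (M - i) 2 + eps 0 i 2 * eps 1 (M - i) 1"
  \<comment> \<open>Here the index counts the edges of the genus 1 component with one face, in the
    theorem those of the genus 0 component with two faces; the summation is reversed.\<close>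
  have "(\<Sum>i\<le>M. eps 1 i 1 * eps 0 (M - i) 2) = (\<Sum>i\<le>M. eps 0 i 2 * eps 1 (M - i) 1)"
    using sum.nat_diff_reindex[of "\<lambda>i. eps 0 i 2 * eps 1 (M - i) 1" "Suc M"]
    by (simp add: lessThan_Suc_atMost mult.commute)
  then have "(\<Sum>i\<le>M. eps 0 i 1 * eps 1 (M - i) 2 + eps 1 i 1 * eps 0 (M - i) 2) = sum ?g {..M}"
    by (simp add: sum.distrib)
  also have "\<dots> = sum ?g {..k} + ?g (Suc k) + ?g (Suc (Suc k))"
    by (simp only: M_def sum.atMost_Suc)
  \<comment> \<open>For the two largest indices the genus 1 factors have one edge or none and
    vanish, so the sum stops at \<open>k\<close>, which is \<open>N - 3\<close>.\<close>
  also have "\<dots> = sum ?g {0..k}"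
    using eps_genus_one_small by (simp add: M_def atMost_atLeast0)
  finally have "(\<Sum>i\<le>M. eps 0 i 1 * eps 1 (M - i) 2 + eps 1 i 1 * eps 0 (M - i) 2) = sum ?g {0..k}" .
  moreover have "N - i - 1 = M - i" for i by (simp add: k M_def)
  moreover have "N - 3 = k" "N - 1 = M" "N = Suc M" by (simp_all add: k M_def)
  ultimately show ?thesis
    using eps_genus_one_pair[of N M] by simp
qed

end
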